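(* Let $F$ be a blackbox quantum update algorithm that performs a quantum Bayesian update on an arbitrary pure state $\sum_{x=1}^N \alpha_x |x\rangle$ using $O(1)$ queries to the oracle $O_E$, is heralded, and has success probability $\Omega\left(\sum_x |\alpha_x|^2 P(E|x)/\Gamma_E\right)$, where $\max_x P(E|x)\le \Gamma_E\le 1$. Then the following are impossible. 1. A blackbox algorithm $G$ capable of performing a quantum Bayesian update of an arbitrary pure quantum state of the form $\sum_{x=1}^N \alpha_x |x\rangle$ that uses $O(1)$ queries to $O_E$, is heralded, and has success probability $\omega\left(\sum_x |\alpha_x|^2 P(E|x)/\Gamma_E\right)$. 2. A blackbox algorithm $H$ that requires $o(\sqrt{N}/\log(N))$ queries to $O_E$ to undo the effects that $F$ applies to the arbitrary state $\sum_{x=1}^N \alpha_x |x\rangle$ upon a failed update. 3. A blackbox algorithm $I$ capable of performing a quantum Bayesian update of an arbitrary pure quantum state of the form $\sum_{x=1}^N \alpha_x |x\rangle$ that, for all $O_E$, uses on average $o(\sqrt{N})$ queries to $O_E$.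
   Context: The latent variable $x$ takes values in $\{1,\dots,N\}$, and $E$ is an observed outcome of an experiment with a discrete set of outcomes. $P(E|x)\in[0,1]$ is the likelihood function. The posterior given a prior $P(x)$ is $P(x|E)=P(E|x)P(x)/\sum_{x'}P(E|x')P(x')$ (defined when the denominator is nonzero). A quantum Bayesian update of a prior state $\sum_x\sqrt{P(x)}|x\rangle$, for observable variable $E$ and likelihood $P(E|x)$, performs the map $\sum_x\sqrt{P(x)}|x\rangle\mapsto\sum_x\sqrt{P(x|E)}|x\rangle$. For an arbitrary pure state $\sum_x\alpha_x|x\rangle$, the squared moduli $|\alpha_x|^2$ play the role of the prior and the update is the map $\sum_x\alpha_x|x\rangle\mapsto \sum_x\alpha_x\sqrt{P(E|x)}\,|x\rangle\big/\sqrt{\sum_x|\alpha_x|^2P(E|x)}$. The oracle $O_E$ is the self-inverse unitary $O_E|x\rangle|y\rangle=|x\rangle|y\oplus P(E|x)\rangle$, where $P(E|x)$ is written as a bit string. "Blackbox" means that the algorithm accesses the likelihood function only through $O_E$ and must work for every likelihood function; operations not involving $O_E$ are free. "Heralded" means that the algorithm reports through a classical flag whether the update succeeded. $H$ "undoes the effects of $F$ upon a failed update" if, applied to the state left by $F$ when its flag reports failure, it restores the input state $\sum_x\alpha_x|x\rangle$. Asymptotic notation is with respect to $N\to\infty$. *)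

theory Defs
  imports "HOL-Analysis.Analysis" "HOL-Library.Landau_Symbols"
begin

section \<open>States and oracle\<close>

text \<open>
  A basis vector \<open>|x\<rangle>|y\<rangle>|w\<rangle>\<close> is labelled by the latent variable \<open>x \<in> {1..N}\<close>, the content \<open>y\<close>
  of the oracle's answer register, and the content \<open>w\<close> of a work register of arbitrary finite
  dimension \<open>W\<close>. Likelihoods are binary fixed-point numbers with one integer bit (so that 1 is a
  value) and \<open>b\<close> fractional bits, hence the answer register has dimension \<open>2 ^ (b + 1)\<close>.
  A state is its family of amplitudes; it is not required to be normalised.
\<close>

type_synonym label = "nat \<times> nat \<times> nat"
type_synonym state = "label \<Rightarrow> complex"
type_synonym operator = "label \<Rightarrow> label \<Rightarrow> complex"

definition labels :: "nat \<Rightarrow> nat \<Rightarrow> nat \<Rightarrow> label set" where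
  "labels N b W = {1..N} \<times> {..<2 ^ (b + 1)} \<times> {..<W}"

definition sq_norm :: "label set \<Rightarrow> state \<Rightarrow> real" where
  "sq_norm B \<psi> = (\<Sum>i\<in>B. (cmod (\<psi> i))\<^sup>2)"

definition apply_operator :: "label set \<Rightarrow> operator \<Rightarrow> state \<Rightarrow> state" where
  "apply_operator B K \<psi> = (\<lambda>i. if i \<in> B then \<Sum>j\<in>B. K i j * \<psi> j else 0)"

text \<open>Completeness relation \<open>\<Sum>k. K\<^sub>k\<^sup>\<dagger> K\<^sub>k = 1\<close> on the space spanned by \<open>B\<close>.\<close>

definition kraus_family :: "label set \<Rightarrow> operator list \<Rightarrow> bool" where
  "kraus_family B Ks \<longleftrightarrow>
     (\<forall>i\<in>B. \<forall>j\<in>B. (\<Sum>k<length Ks. \<Sum>l\<in>B. cnj ((Ks ! k) l i) * (Ks ! k) l j) = (if i = j then 1 else 0))"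

definition likelihood :: "nat \<Rightarrow> nat \<Rightarrow> (nat \<Rightarrow> real) \<Rightarrow> bool" where
  "likelihood N b P \<longleftrightarrow> (\<forall>x\<in>{1..N}. \<exists>k::nat. k \<le> 2 ^ b \<and> P x = real k / 2 ^ b)"

definition bit_string :: "nat \<Rightarrow> real \<Rightarrow> nat" where
  "bit_string b p = nat \<lfloor>p * 2 ^ b\<rfloor>"

text \<open>
  The amplitude of \<open>O\<^sub>E \<psi>\<close> at \<open>|x\<rangle>|y\<rangle>|w\<rangle>\<close> is that of \<open>\<psi>\<close> at the preimage of this basis vector, and
  \<open>y \<mapsto> y \<oplus> P(E|x)\<close> is its own inverse.
\<close>

definition oracle_query :: "nat \<Rightarrow> (nat \<Rightarrow> real) \<Rightarrow> state \<Rightarrow> state" where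
  "oracle_query b P \<psi> = (\<lambda>(x, y, w). \<psi> (x, Bit_Operations.xor y (bit_string b (P x)), w))"

definition basis_state :: "label \<Rightarrow> state" where
  "basis_state i = (\<lambda>j. if j = i then 1 else 0)"

lemma oracle_query_basis_state:
  "oracle_query b P (basis_state (x, y, w)) =
     basis_state (x, Bit_Operations.xor y (bit_string b (P x)), w)"
  by (auto simp: oracle_query_def basis_state_def fun_eq_iff xor.assoc)

lemma oracle_query_involution: "oracle_query b P (oracle_query b P \<psi>) = \<psi>"
  by (auto simp: oracle_query_def fun_eq_iff xor.assoc)


section \<open>Blackbox algorithms\<close>

text \<open>
  An algorithm is a classically controlled program: the next instruction is a function of the
  classical history, that is, the list of the measurement outcomes so far with the most recent one
  first. \<open>Measure Ks\<close> is an arbitrary oracle-independent operation: outcome \<open>k\<close> applies the Kraus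
  operator \<open>Ks ! k\<close>. Unitaries are singleton lists, coin tosses are multiples of the identity, and
  discarding a system is measuring it. A query has the single outcome 0. Programs need not be
  bounded. The argument of \<open>Halt\<close> is the classical success flag.
\<close>

datatype instruction = Halt bool | Query | Measure "operator list"

datatype algorithm = Algorithm (work_dim: nat) (program: "nat list \<Rightarrow> instruction")

abbreviation alg_labels :: "nat \<Rightarrow> nat \<Rightarrow> algorithm \<Rightarrow> label set" where
  "alg_labels N b A \<equiv> labels N b (work_dim A)"

definition well_formed :: "nat \<Rightarrow> nat \<Rightarrow> algorithm \<Rightarrow> bool" where
  "well_formed N b A \<longleftrightarrow>
     work_dim A > 0 \<and> (\<forall>h Ks. program A h = Measure Ks \<longrightarrow> kraus_family (alg_labels N b A) Ks)"

text \<open>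
  \<open>branch N b P A \<psi> h\<close> is the unnormalised state of the branch with history \<open>h\<close> when \<open>A\<close> is run on
  \<open>\<psi>\<close>; its squared norm is the probability of observing \<open>h\<close>.
\<close>

primrec branch :: "nat \<Rightarrow> nat \<Rightarrow> (nat \<Rightarrow> real) \<Rightarrow> algorithm \<Rightarrow> state \<Rightarrow> nat list \<Rightarrow> state" where
  "branch N b P A \<psi> [] = \<psi>"
| "branch N b P A \<psi> (k # h) =
     (case program A h of
        Halt flag \<Rightarrow> (\<lambda>_. 0)
      | Query \<Rightarrow> if k = 0 then oracle_query b P (branch N b P A \<psi> h) else (\<lambda>_. 0)
      | Measure Ks \<Rightarrow>
          if k < length Ks
          then apply_operator (alg_labels N b A) (Ks ! k) (branch N b P A \<psi> h) else (\<lambda>_. 0))"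

definition history_prob :: "nat \<Rightarrow> nat \<Rightarrow> (nat \<Rightarrow> real) \<Rightarrow> algorithm \<Rightarrow> state \<Rightarrow> nat list \<Rightarrow> real" where
  "history_prob N b P A \<psi> h = sq_norm (alg_labels N b A) (branch N b P A \<psi> h)"

definition flag_prob :: "nat \<Rightarrow> nat \<Rightarrow> (nat \<Rightarrow> real) \<Rightarrow> algorithm \<Rightarrow> state \<Rightarrow> bool \<Rightarrow> real" where
  "flag_prob N b P A \<psi> flag = (\<Sum>\<^sub>\<infinity>h\<in>{h. program A h = Halt flag}. history_prob N b P A \<psi> h)"

text \<open>Termination with probability 1, also for unnormalised inputs.\<close>

definition terminates :: "nat \<Rightarrow> nat \<Rightarrow> (nat \<Rightarrow> real) \<Rightarrow> algorithm \<Rightarrow> state \<Rightarrow> bool" where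
  "terminates N b P A \<psi> \<longleftrightarrow>
     flag_prob N b P A \<psi> True + flag_prob N b P A \<psi> False = sq_norm (alg_labels N b A) \<psi>"

primrec num_queries :: "algorithm \<Rightarrow> nat list \<Rightarrow> nat" where
  "num_queries A [] = 0"
| "num_queries A (k # h) = num_queries A h + (if program A h = Query then 1 else 0)"

definition queries_at_most ::
  "nat \<Rightarrow> nat \<Rightarrow> (nat \<Rightarrow> real) \<Rightarrow> algorithm \<Rightarrow> state \<Rightarrow> nat \<Rightarrow> bool" where
  "queries_at_most N b P A \<psi> q \<longleftrightarrow> (\<forall>h. history_prob N b P A \<psi> h > 0 \<longrightarrow> num_queries A h \<le> q)"

text \<open>
  The expected number of queries, as the sum over all potential queries of the probability that
  they are executed. It is infinite if this sum diverges.
\<close>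

definition expected_queries :: "nat \<Rightarrow> nat \<Rightarrow> (nat \<Rightarrow> real) \<Rightarrow> algorithm \<Rightarrow> state \<Rightarrow> ennreal" where
  "expected_queries N b P A \<psi> =
     (\<Sum>\<^sub>\<infinity>h\<in>{h. program A h = Query}. ennreal (history_prob N b P A \<psi> h))"


section \<open>Quantum Bayesian updates\<close>

definition input_state :: "(nat \<Rightarrow> complex) \<Rightarrow> nat \<Rightarrow> state" where
  "input_state \<alpha> N = (\<lambda>(x, y, w). if x \<in> {1..N} \<and> y = 0 \<and> w = 0 then \<alpha> x else 0)"

definition evidence :: "nat \<Rightarrow> (nat \<Rightarrow> real) \<Rightarrow> (nat \<Rightarrow> complex) \<Rightarrow> real" where
  "evidence N P \<alpha> = (\<Sum>x=1..N. (cmod (\<alpha> x))\<^sup>2 * P x)"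

definition updated :: "nat \<Rightarrow> (nat \<Rightarrow> real) \<Rightarrow> (nat \<Rightarrow> complex) \<Rightarrow> nat \<Rightarrow> complex" where
  "updated N P \<alpha> x = \<alpha> x * of_real (sqrt (P x)) / of_real (sqrt (evidence N P \<alpha>))"

text \<open>
  \<open>\<psi>\<close> is the product of \<open>\<Sum>x. \<beta> x |x\<rangle>\<close> with some state of the other two registers, which also
  absorbs the global phase and the norm of \<open>\<psi>\<close>.
\<close>

definition holds_state :: "label set \<Rightarrow> (nat \<Rightarrow> complex) \<Rightarrow> state \<Rightarrow> bool" where
  "holds_state B \<beta> \<psi> \<longleftrightarrow> (\<exists>\<phi>. \<forall>(x, y, w)\<in>B. \<psi> (x, y, w) = \<beta> x * \<phi> (y, w))"

text \<open>
  Problem instances \<open>(N, \<Gamma>, P, \<alpha>)\<close>. The number \<open>b N\<close> of fractional bits of the likelihoods may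
  depend on \<open>N\<close>. The posterior is only defined if the evidence is nonzero.
\<close>

type_synonym problem = "nat \<times> real \<times> (nat \<Rightarrow> real) \<times> (nat \<Rightarrow> complex)"

definition valid_problems :: "(nat \<Rightarrow> nat) \<Rightarrow> problem set" where
  "valid_problems b = {(N, \<Gamma>, P, \<alpha>).
     N \<ge> 1 \<and> likelihood N (b N) P \<and> (\<forall>x\<in>{1..N}. P x \<le> \<Gamma>) \<and> 0 < \<Gamma> \<and> \<Gamma> \<le> 1 \<and>
     (\<Sum>x=1..N. (cmod (\<alpha> x))\<^sup>2) = 1 \<and> evidence N P \<alpha> \<noteq> 0}"

text \<open>An algorithm for the heralded update may depend on \<open>N\<close> and on the known bound \<open>\<Gamma>\<close>.\<close>

definition heralded_update :: "(nat \<Rightarrow> nat) \<Rightarrow> (nat \<Rightarrow> real \<Rightarrow> algorithm) \<Rightarrow> bool" where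
  "heralded_update b F \<longleftrightarrow>
     (\<forall>N\<ge>1. \<forall>\<Gamma>. 0 < \<Gamma> \<and> \<Gamma> \<le> 1 \<longrightarrow> well_formed N (b N) (F N \<Gamma>)) \<and>
     (\<forall>(N, \<Gamma>, P, \<alpha>)\<in>valid_problems b.
        terminates N (b N) P (F N \<Gamma>) (input_state \<alpha> N) \<and>
        (\<forall>h. program (F N \<Gamma>) h = Halt True \<longrightarrow>
           holds_state (alg_labels N (b N) (F N \<Gamma>)) (updated N P \<alpha>)
             (branch N (b N) P (F N \<Gamma>) (input_state \<alpha> N) h)))"

definition constant_queries :: "(nat \<Rightarrow> nat) \<Rightarrow> (nat \<Rightarrow> real \<Rightarrow> algorithm) \<Rightarrow> bool" where
  "constant_queries b F \<longleftrightarrow>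
     (\<exists>q :: nat \<Rightarrow> nat. (\<lambda>N. real (q N)) \<in> O(\<lambda>_. 1) \<and>
        (\<forall>(N, \<Gamma>, P, \<alpha>)\<in>valid_problems b.
           queries_at_most N (b N) P (F N \<Gamma>) (input_state \<alpha> N) (q N)))"

definition success_prob :: "(nat \<Rightarrow> nat) \<Rightarrow> (nat \<Rightarrow> real \<Rightarrow> algorithm) \<Rightarrow> problem \<Rightarrow> real" where
  "success_prob b F = (\<lambda>(N, \<Gamma>, P, \<alpha>). flag_prob N (b N) P (F N \<Gamma>) (input_state \<alpha> N) True)"

definition scaled_evidence :: "problem \<Rightarrow> real" where
  "scaled_evidence = (\<lambda>(N, \<Gamma>, P, \<alpha>). evidence N P \<alpha> / \<Gamma>)"

text \<open>\<open>N \<rightarrow> \<infinity>\<close>, uniformly in \<open>\<Gamma>\<close>, the likelihood and the input state.\<close>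

definition large_problems :: "(nat \<Rightarrow> nat) \<Rightarrow> problem filter" where
  "large_problems b = inf (filtercomap fst at_top) (principal (valid_problems b))"

text \<open>
  A success probability is at most 1, so no algorithm at all succeeds with probability
  \<open>\<omega>(scaled_evidence)\<close> on families of problems whose scaled evidence stays bounded away from 0. The
  superlinear gain is therefore demanded only where it is not excluded for this trivial reason:
  as the scaled evidence tends to 0.
\<close>

definition large_hard_problems :: "(nat \<Rightarrow> nat) \<Rightarrow> problem filter" where
  "large_hard_problems b = inf (large_problems b) (filtercomap scaled_evidence (nhds 0))"

text \<open>
  \<open>H N \<Gamma> h\<close> is run on the state that \<open>F N \<Gamma>\<close> leaves in a failing branch with history \<open>h\<close>. The work
  register of \<open>F\<close> is part of that of \<open>H\<close>, whose remaining basis vectors have amplitude 0 initially.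
\<close>

definition undoes_failure ::
  "(nat \<Rightarrow> nat) \<Rightarrow> (nat \<Rightarrow> real \<Rightarrow> algorithm) \<Rightarrow> (nat \<Rightarrow> real \<Rightarrow> nat list \<Rightarrow> algorithm) \<Rightarrow>
   (nat \<Rightarrow> nat) \<Rightarrow> bool" where
  "undoes_failure b F H q \<longleftrightarrow>
     (\<forall>N\<ge>1. \<forall>\<Gamma>. 0 < \<Gamma> \<and> \<Gamma> \<le> 1 \<longrightarrow> (\<forall>h. program (F N \<Gamma>) h = Halt False \<longrightarrow>
        well_formed N (b N) (H N \<Gamma> h) \<and> work_dim (F N \<Gamma>) \<le> work_dim (H N \<Gamma> h))) \<and>
     (\<forall>(N, \<Gamma>, P, \<alpha>)\<in>valid_problems b. \<forall>h. program (F N \<Gamma>) h = Halt False \<longrightarrow>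
        (let A = H N \<Gamma> h; \<psi> = branch N (b N) P (F N \<Gamma>) (input_state \<alpha> N) h in
           terminates N (b N) P A \<psi> \<and>
           queries_at_most N (b N) P A \<psi> (q N) \<and>
           (\<forall>g flag. program A g = Halt flag \<longrightarrow>
              holds_state (alg_labels N (b N) A) \<alpha> (branch N (b N) P A \<psi> g))))"

text \<open>An update that always succeeds, with expected number of queries at most \<open>q N\<close>.\<close>

definition update_with_expected_queries ::
  "(nat \<Rightarrow> nat) \<Rightarrow> (nat \<Rightarrow> algorithm) \<Rightarrow> (nat \<Rightarrow> real) \<Rightarrow> bool" where
  "update_with_expected_queries b I q \<longleftrightarrow>
     (\<forall>N\<ge>1. well_formed N (b N) (I N)) \<and>
     (\<forall>(N, \<Gamma>, P, \<alpha>)\<in>valid_problems b.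
        terminates N (b N) P (I N) (input_state \<alpha> N) \<and>
        expected_queries N (b N) P (I N) (input_state \<alpha> N) \<le> ennreal (q N) \<and>
        (\<forall>h flag. program (I N) h = Halt flag \<longrightarrow>
           holds_state (alg_labels N (b N) (I N)) (updated N P \<alpha>)
             (branch N (b N) P (I N) (input_state \<alpha> N) h)))"

end

theory Submission
  imports Defs
begin

text \<open>
  All three bounds compare the runs on oracles marked at \<open>m\<close> with one reference run on an oracle that
  agrees with them off \<open>m\<close>, summed over all \<open>m\<close>. A query changes the comparison only through the
  components with latent variable \<open>m\<close>, and the weights of these components in the reference run sum to
  at most 1.

  For the undoing algorithm \<open>H\<close> and the update \<open>I\<close>, the compared quantity is the real part of the
  overlap with the reference run. With marked likelihood 1, unmarked likelihood \<open>1/2\<close> and a prior that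
  weighs the marked value substantially, a successful update lowers the overlap by a constant, whereas
  undoing a failure restores it. The total loss over \<open>K\<close> marked values is therefore of order \<open>K\<close>, but \<open>Q\<close>
  queries lose at most \<open>2 * Q * sqrt K\<close>. A single update and its undoing suffice, so that even
  \<open>o(sqrt N)\<close> queries are excluded for \<open>H\<close>.

  For \<open>G\<close>, the prior is uniform, the marked likelihood is 1, the unmarked likelihood is 0, and the
  compared quantity is the squared distance. A bounded number of queries makes the distances, and
  hence the success probabilities, sum to \<open>O(1)\<close> over the \<open>N\<close> marked values; one of them is \<open>O(1/N)\<close>, which
  is of the order of the evidence.
\<close>

section \<open>The execution tree of an algorithm and sums over its leaves\<close>

section \<open>Histories\<close>

primrec outcomes :: "instruction \<Rightarrow> nat" where
  "outcomes (Halt flag) = 0"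
| "outcomes Query = 1"
| "outcomes (Measure Ks) = length Ks"

text \<open>The levels of the execution tree depend on the program alone, not on the oracle or the
  input. Runs of one algorithm on different problems can therefore be compared history by history,
  and every level is finite.\<close>

primrec histories :: "algorithm \<Rightarrow> nat \<Rightarrow> nat list set" where
  "histories A 0 = {[]}"
| "histories A (Suc t) =
     (\<lambda>(h, k). k # h) ` (SIGMA h : histories A t. {..<outcomes (program A h)})"

definition past :: "algorithm \<Rightarrow> nat \<Rightarrow> nat list set" where
  "past A t = (\<Union>s<t. histories A s)"

definition halted :: "algorithm \<Rightarrow> nat \<Rightarrow> nat list set" where
  "halted A t = {h \<in> past A t. \<exists>flag. program A h = Halt flag}"

definition flagged :: "algorithm \<Rightarrow> bool \<Rightarrow> nat \<Rightarrow> nat list set" where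
  "flagged A flag t = {h \<in> past A t. program A h = Halt flag}"

definition asking :: "algorithm \<Rightarrow> nat \<Rightarrow> nat list set" where
  "asking A t = {h \<in> past A t. program A h = Query}"

lemma finite_histories [simp]: "finite (histories A t)"
  by (induction t) auto

lemma length_histories: "h \<in> histories A t \<Longrightarrow> length h = t"
  by (induction t arbitrary: h) auto

lemma past_0 [simp]: "past A 0 = {}"
  by (simp add: past_def)

lemma past_Suc: "past A (Suc t) = histories A t \<union> past A t"
  by (auto simp: past_def less_Suc_eq)

lemma finite_past [simp]: "finite (past A t)"
  by (simp add: past_def)

lemma finite_halted [simp]: "finite (halted A t)"
  by (simp add: halted_def)

lemma finite_flagged [simp]: "finite (flagged A flag t)"
  by (simp add: flagged_def)

lemma finite_asking [simp]: "finite (asking A t)"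
  by (simp add: asking_def)

lemma histories_past_disjoint: "histories A t \<inter> past A t = {}"
  by (auto simp: past_def dest!: length_histories)

lemma sum_halted: "(\<Sum>h\<in>halted A t. f h) = (\<Sum>h\<in>flagged A True t. f h) + (\<Sum>h\<in>flagged A False t. f h)"
proof -
  have "halted A t = flagged A True t \<union> flagged A False t"
    unfolding halted_def flagged_def by (auto simp: ex_bool_eq)
  moreover have "flagged A True t \<inter> flagged A False t = {}"
    by (auto simp: flagged_def)
  ultimately show ?thesis
    by (simp add: sum.union_disjoint)
qed

lemma sum_histories_Suc:
  "(\<Sum>h\<in>histories A (Suc t). V h) =
     (\<Sum>h\<in>histories A t. \<Sum>k<outcomes (program A h). V (k # h))"
proof -
  have "inj_on (\<lambda>(h, k). k # h) (SIGMA h : histories A t. {..<outcomes (program A h)})"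
    by (auto simp: inj_on_def)
  then show ?thesis
    by (simp add: sum.reindex sum.Sigma case_prod_unfold)
qed

text \<open>The sets \<open>histories A t\<close> and \<open>halted A t\<close> together are the leaves of the execution tree cut off
  at time \<open>t\<close>.\<close>

lemma sum_leaves_le:
  fixes V W :: "nat list \<Rightarrow> real"
  assumes query: "\<And>h. program A h = Query \<Longrightarrow> V (0 # h) \<le> V h + W h"
    and measure: "\<And>h Ks. program A h = Measure Ks \<Longrightarrow> (\<Sum>k<length Ks. V (k # h)) \<le> V h"
  shows "(\<Sum>h\<in>histories A t. V h) + (\<Sum>h\<in>halted A t. V h) \<le> V [] + (\<Sum>h\<in>asking A t. W h)"
proof (induction t)
  case 0
  then show ?case by (simp add: halted_def asking_def)
next
  case (Suc t)
  let ?q = "\<lambda>h. if program A h = Query then W h else 0"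
  let ?s = "\<lambda>h. if \<exists>flag. program A h = Halt flag then V h else 0"
  \<comment> \<open>A halting history has no children: its value passes unchanged from the open
    level to the halted leaves.\<close>
  have step: "(\<Sum>k<outcomes (program A h). V (k # h)) + ?s h \<le> V h + ?q h" for h
    using query[of h] measure[of h] by (cases "program A h") auto
  have asking: "(\<Sum>h\<in>asking A s. W h) = (\<Sum>h\<in>past A s. ?q h)" for s
    by (simp add: asking_def sum.inter_filter)
  have halted: "(\<Sum>h\<in>halted A s. V h) = (\<Sum>h\<in>past A s. ?s h)" for s
    unfolding halted_def by (simp only: sum.inter_filter finite_past)
  have "(\<Sum>h\<in>histories A (Suc t). V h) + (\<Sum>h\<in>histories A t. ?s h) \<le>
      (\<Sum>h\<in>histories A t. V h) + (\<Sum>h\<in>histories A t. ?q h)"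
    unfolding sum_histories_Suc sum.distrib[symmetric] by (intro sum_mono step)
  with Suc.IH show ?case
    unfolding asking halted past_Suc
    by (simp add: sum.union_disjoint histories_past_disjoint)
qed

text \<open>A conserved quantity satisfies the preceding inequality with query cost 0, and so does
  its negative.\<close>

lemma sum_leaves:
  fixes V :: "nat list \<Rightarrow> real"
  assumes "\<And>h. program A h = Query \<Longrightarrow> V (0 # h) = V h"
    and "\<And>h Ks. program A h = Measure Ks \<Longrightarrow> (\<Sum>k<length Ks. V (k # h)) = V h"
  shows "(\<Sum>h\<in>histories A t. V h) + (\<Sum>h\<in>halted A t. V h) = V []"
proof (rule antisym)
  show "(\<Sum>h\<in>histories A t. V h) + (\<Sum>h\<in>halted A t. V h) \<le> V []"
    using sum_leaves_le[of A V "\<lambda>_. 0" t] assms by simp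
  show "V [] \<le> (\<Sum>h\<in>histories A t. V h) + (\<Sum>h\<in>halted A t. V h)"
    using sum_leaves_le[of A "\<lambda>h. - V h" "\<lambda>_. 0" t] assms by (simp add: sum_negf)
qed


section \<open>Inner products, norms and the effect of oracle-independent operations\<close>

section \<open>Overlaps\<close>

definition overlap :: "label set \<Rightarrow> state \<Rightarrow> state \<Rightarrow> complex" where
  "overlap B \<psi> \<phi> = (\<Sum>i\<in>B. cnj (\<psi> i) * \<phi> i)"

definition latent :: "label set \<Rightarrow> nat \<Rightarrow> label set" where
  "latent B m = {i \<in> B. fst i = m}"

lemma finite_labels [simp]: "finite (labels N b W)"
  by (simp add: labels_def)

lemma finite_latent [simp]: "finite B \<Longrightarrow> finite (latent B m)"
  by (simp add: latent_def)

lemma sq_norm_nonneg [simp]: "sq_norm B \<psi> \<ge> 0"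
  by (simp add: sq_norm_def sum_nonneg)

lemma sq_norm_zero [simp]: "sq_norm B (\<lambda>_. 0) = 0"
  by (simp add: sq_norm_def)

lemma overlap_self: "overlap B \<psi> \<psi> = of_real (sq_norm B \<psi>)"
  by (simp add: overlap_def sq_norm_def complex_norm_square mult.commute del: of_real_power)

lemma Re_cnj_mult_le: "Re (cnj a * c) \<le> ((cmod a)\<^sup>2 + (cmod c)\<^sup>2) / 2"
proof -
  have "Re (cnj a * c) \<le> cmod a * cmod c"
    using complex_Re_le_cmod[of "cnj a * c"] by (simp add: norm_mult)
  also have "\<dots> \<le> ((cmod a)\<^sup>2 + (cmod c)\<^sup>2) / 2"
    using sum_squares_bound[of "cmod a" "cmod c"] by simp
  finally show ?thesis .
qed

text \<open>The arithmetic mean replaces the geometric mean of Cauchy-Schwarz so that the bound is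
  linear in the branch probabilities and can be summed over branches.\<close>

lemma overlap_le: "Re (overlap B \<psi> \<phi>) \<le> (sq_norm B \<psi> + sq_norm B \<phi>) / 2"
proof -
  have "Re (overlap B \<psi> \<phi>) \<le> (\<Sum>i\<in>B. ((cmod (\<psi> i))\<^sup>2 + (cmod (\<phi> i))\<^sup>2) / 2)"
    unfolding overlap_def Re_sum by (intro sum_mono Re_cnj_mult_le)
  then show ?thesis
    by (simp add: sq_norm_def sum_divide_distrib sum.distrib add_divide_distrib)
qed

text \<open>For two product states the overlap factors into the overlap of the latent parts and that
  of the remaining registers. The first is a fixed nonnegative number. The second is at most the
  mean of the squared norms, because the latent parts are normalised.\<close>

lemma overlap_holds_state:
  fixes r s :: "nat \<Rightarrow> real"
  assumes \<psi>: "holds_state (labels N b W) (\<lambda>x. of_real (r x)) \<psi>"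
    and \<phi>: "holds_state (labels N b W) (\<lambda>x. of_real (s x)) \<phi>"
    and r: "(\<Sum>x=1..N. (r x)\<^sup>2) = 1" and s: "(\<Sum>x=1..N. (s x)\<^sup>2) = 1"
    and rs: "(\<Sum>x=1..N. r x * s x) \<ge> 0"
  shows "Re (overlap (labels N b W) \<psi> \<phi>) \<le>
    (\<Sum>x=1..N. r x * s x) * ((sq_norm (labels N b W) \<psi> + sq_norm (labels N b W) \<phi>) / 2)"
proof -
  define R where "R = {..<2 ^ (b + 1) :: nat} \<times> {..<W}"
  have labels: "labels N b W = {1..N} \<times> R"
    by (simp add: labels_def R_def)
  obtain j where j: "\<psi> (x, z) = of_real (r x) * j z" if "x \<in> {1..N}" "z \<in> R" for x z
    using \<psi> unfolding holds_state_def labels by (force simp: R_def)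
  obtain k where k: "\<phi> (x, z) = of_real (s x) * k z" if "x \<in> {1..N}" "z \<in> R" for x z
    using \<phi> unfolding holds_state_def labels by (force simp: R_def)
  have sq\<psi>: "sq_norm (labels N b W) \<psi> = (\<Sum>z\<in>R. (cmod (j z))\<^sup>2)"
  proof -
    have "sq_norm (labels N b W) \<psi> = (\<Sum>x=1..N. \<Sum>z\<in>R. (r x)\<^sup>2 * (cmod (j z))\<^sup>2)"
      unfolding sq_norm_def labels
      by (simp add: sum.cartesian_product' j norm_mult power_mult_distrib)
    then show ?thesis
      by (simp only: sum_product[symmetric] r mult_1)
  qed
  have sq\<phi>: "sq_norm (labels N b W) \<phi> = (\<Sum>z\<in>R. (cmod (k z))\<^sup>2)"
  proof -
    have "sq_norm (labels N b W) \<phi> = (\<Sum>x=1..N. \<Sum>z\<in>R. (s x)\<^sup>2 * (cmod (k z))\<^sup>2)"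
      unfolding sq_norm_def labels
      by (simp add: sum.cartesian_product' k norm_mult power_mult_distrib)
    then show ?thesis
      by (simp only: sum_product[symmetric] s mult_1)
  qed
  have "Re (overlap (labels N b W) \<psi> \<phi>) = (\<Sum>x=1..N. \<Sum>z\<in>R. (r x * s x) * Re (cnj (j z) * k z))"
    unfolding overlap_def labels Re_sum
    by (simp add: sum.cartesian_product' j k algebra_simps)
  also have "\<dots> = (\<Sum>x=1..N. r x * s x) * (\<Sum>z\<in>R. Re (cnj (j z) * k z))"
    by (simp only: sum_product)
  also have "\<dots> \<le> (\<Sum>x=1..N. r x * s x) * (\<Sum>z\<in>R. ((cmod (j z))\<^sup>2 + (cmod (k z))\<^sup>2) / 2)"
    by (intro mult_left_mono rs sum_mono Re_cnj_mult_le)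
  finally show ?thesis
    by (simp add: sq\<psi> sq\<phi> sum.distrib add_divide_distrib sum_divide_distrib)
qed

text \<open>The subspaces for different values of the latent variable are orthogonal. This is the
  source of the square root in the bounds: one state cannot put much weight on every marked value at
  once.\<close>

lemma sum_sq_norm_latent_le:
  assumes "finite B" "finite M"
  shows "(\<Sum>m\<in>M. sq_norm (latent B m) \<psi>) \<le> sq_norm B \<psi>"
proof -
  have "(\<Sum>m\<in>M. sq_norm (latent B m) \<psi>) = (\<Sum>i\<in>(\<Union>m\<in>M. latent B m). (cmod (\<psi> i))\<^sup>2)"
    unfolding sq_norm_def using assms by (subst sum.UNION_disjoint) (auto simp: latent_def)
  also have "\<dots> \<le> sq_norm B \<psi>"
    unfolding sq_norm_def using assms by (intro sum_mono2) (auto simp: latent_def)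
  finally show ?thesis .
qed

lemma sq_norm_latent_le: "finite B \<Longrightarrow> sq_norm (latent B m) \<psi> \<le> sq_norm B \<psi>"
  using sum_sq_norm_latent_le[of B "{m}" \<psi>] by simp

lemma sq_norm_add_le: "sq_norm B (\<lambda>i. \<psi> i + \<phi> i) \<le> 2 * sq_norm B \<psi> + 2 * sq_norm B \<phi>"
proof -
  have "(cmod (\<psi> i + \<phi> i))\<^sup>2 \<le> 2 * (cmod (\<psi> i))\<^sup>2 + 2 * (cmod (\<phi> i))\<^sup>2" for i
  proof -
    have "(cmod (\<psi> i + \<phi> i))\<^sup>2 \<le> (cmod (\<psi> i) + cmod (\<phi> i))\<^sup>2"
      by (intro power_mono norm_triangle_ineq) simp
    also have "\<dots> \<le> 2 * (cmod (\<psi> i))\<^sup>2 + 2 * (cmod (\<phi> i))\<^sup>2"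
      using sum_squares_bound[of "cmod (\<psi> i)" "cmod (\<phi> i)"] by (simp add: power2_sum)
    finally show ?thesis .
  qed
  then show ?thesis
    unfolding sq_norm_def sum_distrib_left sum.distrib[symmetric] by (intro sum_mono)
qed

text \<open>Expanding both states and moving the sums over \<open>k\<close> and \<open>l\<close>
  innermost exposes the completeness relation. Hence a measurement preserves inner products in
  total, as a unitary does.\<close>

lemma overlap_kraus:
  assumes "finite B" and "kraus_family B Ks"
  shows "(\<Sum>k<length Ks. overlap B (apply_operator B (Ks ! k) \<psi>) (apply_operator B (Ks ! k) \<phi>)) =
    overlap B \<psi> \<phi>"
proof -
  have "(\<Sum>k<length Ks. overlap B (apply_operator B (Ks ! k) \<psi>) (apply_operator B (Ks ! k) \<phi>)) =
     (\<Sum>k<length Ks. \<Sum>l\<in>B. \<Sum>i\<in>B. \<Sum>j\<in>B. (cnj ((Ks ! k) l i) * (Ks ! k) l j) * (cnj (\<psi> i) * \<phi> j))"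
    by (simp add: overlap_def apply_operator_def sum_product cong: sum.cong) (simp add: mult_ac)
  also have "\<dots> = (\<Sum>k<length Ks. \<Sum>i\<in>B. \<Sum>l\<in>B. \<Sum>j\<in>B. (cnj ((Ks ! k) l i) * (Ks ! k) l j) * (cnj (\<psi> i) * \<phi> j))"
    by (rule sum.cong[OF refl], rule sum.swap)
  also have "\<dots> = (\<Sum>i\<in>B. \<Sum>k<length Ks. \<Sum>l\<in>B. \<Sum>j\<in>B. (cnj ((Ks ! k) l i) * (Ks ! k) l j) * (cnj (\<psi> i) * \<phi> j))"
    by (rule sum.swap)
  also have "\<dots> = (\<Sum>i\<in>B. \<Sum>k<length Ks. \<Sum>j\<in>B. \<Sum>l\<in>B. (cnj ((Ks ! k) l i) * (Ks ! k) l j) * (cnj (\<psi> i) * \<phi> j))"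
    by (rule sum.cong[OF refl], rule sum.cong[OF refl], rule sum.swap)
  also have "\<dots> = (\<Sum>i\<in>B. \<Sum>j\<in>B. \<Sum>k<length Ks. \<Sum>l\<in>B. (cnj ((Ks ! k) l i) * (Ks ! k) l j) * (cnj (\<psi> i) * \<phi> j))"
    by (rule sum.cong[OF refl], rule sum.swap)
  also have "\<dots> = (\<Sum>i\<in>B. \<Sum>j\<in>B. (if i = j then 1 else 0) * (cnj (\<psi> i) * \<phi> j))"
    using assms(2) by (simp add: kraus_family_def sum_distrib_right[symmetric])
  also have "\<dots> = overlap B \<psi> \<phi>"
    using assms(1) by (simp add: overlap_def if_distrib[of "\<lambda>c. c * _"] cong: if_cong)
  finally show ?thesis .
qed

lemma sq_norm_kraus:
  assumes "finite B" and "kraus_family B Ks"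
  shows "(\<Sum>k<length Ks. sq_norm B (apply_operator B (Ks ! k) \<psi>)) = sq_norm B \<psi>"
  using arg_cong[OF overlap_kraus[OF assms, of \<psi> \<psi>], of Re] by (simp add: overlap_self)

section \<open>A query as a permutation of basis labels, and the cost of changing the oracle\<close>

definition query_label :: "nat \<Rightarrow> (nat \<Rightarrow> real) \<Rightarrow> label \<Rightarrow> label" where
  "query_label b P = (\<lambda>(x, y, w). (x, Bit_Operations.xor y (bit_string b (P x)), w))"

lemma oracle_query_eq: "oracle_query b P \<psi> i = \<psi> (query_label b P i)"
  by (cases i) (simp add: oracle_query_def query_label_def)

lemma query_label_involution [simp]: "query_label b P (query_label b P i) = i"
  by (cases i) (simp add: query_label_def xor.assoc)

lemma fst_query_label [simp]: "fst (query_label b P i) = fst i"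
  by (cases i) (simp add: query_label_def)

lemma bit_string_less:
  assumes "likelihood N b P" and "x \<in> {1..N}"
  shows "bit_string b (P x) < 2 ^ (b + 1)"
proof -
  obtain k :: nat where k: "k \<le> 2 ^ b" "P x = real k / 2 ^ b"
    using assms unfolding likelihood_def by blast
  then have "bit_string b (P x) = k"
    by (simp add: bit_string_def)
  \<comment> \<open>Likelihood 1 is encoded as \<open>2 ^ b\<close>, which takes up the integer
    bit.\<close>
  moreover have "(2::nat) ^ b < 2 ^ (b + 1)"
    by simp
  ultimately show ?thesis
    using k(1) by linarith
qed

lemma xor_less_power:
  fixes x y :: nat
  assumes "x < 2 ^ n" and "y < 2 ^ n"
  shows "Bit_Operations.xor x y < 2 ^ n"
  using assms by (simp add: take_bit_nat_eq_self_iff[symmetric])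

lemma query_label_in:
  assumes "likelihood N b P" and "i \<in> labels N b W"
  shows "query_label b P i \<in> labels N b W"
  using assms bit_string_less[OF assms(1)] xor_less_power
  by (auto simp: labels_def query_label_def simp del: power_Suc One_nat_def)

lemma sum_query_label:
  assumes "likelihood N b P"
  shows "(\<Sum>i\<in>labels N b W. f (query_label b P i)) = (\<Sum>i\<in>labels N b W. f i)"
  by (rule sum.reindex_bij_witness[where i = "query_label b P" and j = "query_label b P"])
    (use assms query_label_in in auto)

lemma sum_query_label_latent:
  assumes "likelihood N b P"
  shows "(\<Sum>i\<in>latent (labels N b W) m. f (query_label b P i)) = (\<Sum>i\<in>latent (labels N b W) m. f i)"
  by (rule sum.reindex_bij_witness[where i = "query_label b P" and j = "query_label b P"])
    (use assms query_label_in in \<open>auto simp: latent_def\<close>)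

lemma sq_norm_query:
  "likelihood N b P \<Longrightarrow> sq_norm (labels N b W) (oracle_query b P \<psi>) = sq_norm (labels N b W) \<psi>"
  unfolding sq_norm_def oracle_query_eq by (rule sum_query_label)

lemma sq_norm_latent_query:
  "likelihood N b P \<Longrightarrow>
     sq_norm (latent (labels N b W) m) (oracle_query b P \<psi>) = sq_norm (latent (labels N b W) m) \<psi>"
  unfolding sq_norm_def oracle_query_eq by (rule sum_query_label_latent)

lemma overlap_query_same:
  "likelihood N b P \<Longrightarrow>
     overlap (labels N b W) (oracle_query b P \<psi>) (oracle_query b P \<phi>) = overlap (labels N b W) \<psi> \<phi>"
  unfolding overlap_def oracle_query_eq by (rule sum_query_label)

lemma oracle_query_cong:
  assumes "P (fst i) = P' (fst i)"
  shows "oracle_query b P \<psi> i = oracle_query b P' \<psi> i"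
  using assms by (cases i) (simp add: oracle_query_def)

text \<open>Querying both states with the same oracle \<open>P'\<close> would preserve the overlap.
  Using \<open>P\<close> on the first state instead changes only components with latent variable
  \<open>m\<close>. Young's inequality with the free parameter \<open>c\<close> splits the change
  into a part for each state, so that the two can be weighted differently.\<close>

lemma overlap_query:
  fixes W :: nat
  assumes P: "likelihood N b P" and P': "likelihood N b P'"
    and agree: "\<And>x. x \<in> {1..N} \<Longrightarrow> x \<noteq> m \<Longrightarrow> P x = P' x" and "c > 0"
  defines "B \<equiv> labels N b W"
  shows "Re (overlap B \<psi> \<phi>) \<le> Re (overlap B (oracle_query b P \<psi>) (oracle_query b P' \<phi>)) +
    (c * sq_norm (latent B m) \<psi> + sq_norm (latent B m) \<phi> / c)"
proof -
  \<comment> \<open>The hybrid state: the marked run queried with the reference oracle.\<close>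
  define \<psi>' where "\<psi>' = oracle_query b P' \<psi>"
  define \<psi>'' where "\<psi>'' = oracle_query b P \<psi>"
  define \<phi>' where "\<phi>' = oracle_query b P' \<phi>"
  define L where "L = latent B m"
  have fin: "finite B" and L: "L \<subseteq> B"
    by (auto simp: B_def L_def latent_def)
  have off: "cnj (\<psi>' i) * \<phi>' i - cnj (\<psi>'' i) * \<phi>' i = 0" if "i \<in> B - L" for i
  proof -
    have "fst i \<in> {1..N}" "fst i \<noteq> m"
      using that by (auto simp: B_def L_def latent_def labels_def)
    then show ?thesis
      using oracle_query_cong[of P i P' b \<psi>] agree by (simp add: \<psi>'_def \<psi>''_def)
  qed
  have amgm: "cmod a * cmod d \<le> (c * (cmod a)\<^sup>2 + (cmod d)\<^sup>2 / c) / 2" for a d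
  proof -
    have "2 * (c * cmod a) * cmod d \<le> (c * cmod a)\<^sup>2 + (cmod d)\<^sup>2"
      by (rule sum_squares_bound)
    then show ?thesis
      using \<open>c > 0\<close> by (simp add: field_simps power2_eq_square)
  qed
  have point: "Re (cnj (\<psi>' i) * \<phi>' i - cnj (\<psi>'' i) * \<phi>' i) \<le>
      c * (cmod (\<psi>' i))\<^sup>2 / 2 + c * (cmod (\<psi>'' i))\<^sup>2 / 2 + (cmod (\<phi>' i))\<^sup>2 / c" for i
  proof -
    have "Re (cnj (\<psi>' i) * \<phi>' i - cnj (\<psi>'' i) * \<phi>' i) \<le>
        cmod (cnj (\<psi>' i) * \<phi>' i - cnj (\<psi>'' i) * \<phi>' i)"
      by (rule complex_Re_le_cmod)
    also have "\<dots> \<le> cmod (\<psi>' i) * cmod (\<phi>' i) + cmod (\<psi>'' i) * cmod (\<phi>' i)"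
      by (rule order.trans[OF norm_triangle_ineq4]) (simp add: norm_mult)
    finally show ?thesis
      using amgm[of "\<psi>' i" "\<phi>' i"] amgm[of "\<psi>'' i" "\<phi>' i"] by (simp add: add_divide_distrib)
  qed
  have "Re (overlap B \<psi> \<phi>) - Re (overlap B \<psi>'' \<phi>') = Re (overlap B \<psi>' \<phi>' - overlap B \<psi>'' \<phi>')"
    using overlap_query_same[OF P', of W \<psi> \<phi>] by (simp add: B_def \<psi>'_def \<phi>'_def)
  also have "overlap B \<psi>' \<phi>' - overlap B \<psi>'' \<phi>' = (\<Sum>i\<in>B. cnj (\<psi>' i) * \<phi>' i - cnj (\<psi>'' i) * \<phi>' i)"
    by (simp add: overlap_def sum_subtractf)
  also have "\<dots> = (\<Sum>i\<in>L. cnj (\<psi>' i) * \<phi>' i - cnj (\<psi>'' i) * \<phi>' i)"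
    using fin L off by (intro sum.mono_neutral_right) auto
  also have "Re \<dots> \<le> (\<Sum>i\<in>L. c * (cmod (\<psi>' i))\<^sup>2 / 2 + c * (cmod (\<psi>'' i))\<^sup>2 / 2 + (cmod (\<phi>' i))\<^sup>2 / c)"
    unfolding Re_sum by (intro sum_mono point)
  also have "\<dots> = c * sq_norm L \<psi>' / 2 + c * sq_norm L \<psi>'' / 2 + sq_norm L \<phi>' / c"
    by (simp add: sq_norm_def sum.distrib sum_distrib_left sum_divide_distrib)
  also have "\<dots> = c * sq_norm L \<psi> + sq_norm L \<phi> / c"
    using sq_norm_latent_query[OF P] sq_norm_latent_query[OF P']
    by (simp add: L_def B_def \<psi>'_def \<psi>''_def \<phi>'_def)
  finally show ?thesis
    by (simp add: L_def \<psi>''_def \<phi>'_def)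
qed

text \<open>The difference splits into the query by \<open>P\<close> of the old difference and the
  disagreement of the two oracles on \<open>\<phi>\<close>. The doubling per query is harmless for
  boundedly many queries. In return, only the weight at \<open>m\<close> of the reference state
  \<open>\<phi>\<close> enters.\<close>

lemma sq_norm_query_diff:
  fixes W :: nat
  assumes P: "likelihood N b P" and P': "likelihood N b P'"
    and agree: "\<And>x. x \<in> {1..N} \<Longrightarrow> x \<noteq> m \<Longrightarrow> P x = P' x"
  defines "B \<equiv> labels N b W"
  shows "sq_norm B (\<lambda>i. oracle_query b P \<psi> i - oracle_query b P' \<phi> i) \<le>
    2 * sq_norm B (\<lambda>i. \<psi> i - \<phi> i) + 8 * sq_norm (latent B m) \<phi>"
proof -
  let ?d = "\<lambda>i. oracle_query b P \<phi> i - oracle_query b P' \<phi> i"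
  have "sq_norm B (\<lambda>i. oracle_query b P \<psi> i - oracle_query b P' \<phi> i) =
      sq_norm B (\<lambda>i. oracle_query b P (\<lambda>i. \<psi> i - \<phi> i) i + ?d i)"
    by (simp add: oracle_query_eq)
  also have "\<dots> \<le> 2 * sq_norm B (oracle_query b P (\<lambda>i. \<psi> i - \<phi> i)) + 2 * sq_norm B ?d"
    by (rule sq_norm_add_le)
  also have "sq_norm B (oracle_query b P (\<lambda>i. \<psi> i - \<phi> i)) = sq_norm B (\<lambda>i. \<psi> i - \<phi> i)"
    unfolding B_def by (rule sq_norm_query[OF P])
  also have "sq_norm B ?d = sq_norm (latent B m) ?d"
    unfolding sq_norm_def
  proof (rule sum.mono_neutral_right)
    show "\<forall>i\<in>B - latent B m. (cmod (?d i))\<^sup>2 = 0"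
    proof
      fix i assume "i \<in> B - latent B m"
      then have "fst i \<in> {1..N}" "fst i \<noteq> m"
        by (auto simp: B_def latent_def labels_def)
      then show "(cmod (?d i))\<^sup>2 = 0"
        using oracle_query_cong[of P i P' b \<phi>] agree by simp
    qed
  qed (auto simp: B_def latent_def)
  also have "sq_norm (latent B m) ?d \<le>
      2 * sq_norm (latent B m) (oracle_query b P \<phi>) + 2 * sq_norm (latent B m) (\<lambda>i. - oracle_query b P' \<phi> i)"
    using sq_norm_add_le[of "latent B m" "oracle_query b P \<phi>" "\<lambda>i. - oracle_query b P' \<phi> i"] by simp
  also have "\<dots> = 4 * sq_norm (latent B m) \<phi>"
    using sq_norm_latent_query[OF P, of W m \<phi>] sq_norm_latent_query[OF P', of W m \<phi>]
    by (simp add: sq_norm_def B_def)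
  finally show ?thesis by simp
qed

section \<open>Probabilities and query counts along a single run\<close>

section \<open>Runs of an algorithm\<close>

context
  fixes N b :: nat and P :: "nat \<Rightarrow> real" and A :: algorithm and \<psi> :: state
begin

lemma branch_Query:
  "program A h = Query \<Longrightarrow> branch N b P A \<psi> (0 # h) = oracle_query b P (branch N b P A \<psi> h)"
  by simp

lemma branch_outside_histories:
  "h \<notin> histories A (length h) \<Longrightarrow> branch N b P A \<psi> h = (\<lambda>_. 0)"
proof (induction h)
  case (Cons k h)
  show ?case
  proof (cases "h \<in> histories A (length h)")
    case True
    then have "\<not> k < outcomes (program A h)"
      using Cons.prems by force
    then show ?thesis
      by (cases "program A h") auto
  next
    case False
    then have "branch N b P A \<psi> h = (\<lambda>_. 0)"
      using Cons.IH by simp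
    then show ?thesis
      by (cases "program A h") (auto simp: oracle_query_eq apply_operator_def)
  qed
qed simp

lemma history_prob_nonneg [simp]: "history_prob N b P A \<psi> h \<ge> 0"
  by (simp add: history_prob_def)

lemma history_prob_Nil: "history_prob N b P A \<psi> [] = sq_norm (alg_labels N b A) \<psi>"
  by (simp add: history_prob_def)

text \<open>Approximates the infinite sum from below by the finite cut-off trees, so that all later
  estimates concern finite sums.\<close>

lemma flag_prob_less_flagged:
  assumes "\<eta> > 0"
  shows "\<forall>\<^sub>F t in sequentially.
    flag_prob N b P A \<psi> flag < (\<Sum>h\<in>flagged A flag t. history_prob N b P A \<psi> h) + \<eta>"
proof -
  let ?p = "history_prob N b P A \<psi>" and ?H = "{h. program A h = Halt flag}"
  have "\<exists>S. finite S \<and> S \<subseteq> ?H \<and> flag_prob N b P A \<psi> flag < sum ?p S + \<eta>"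
  proof (cases "?p summable_on ?H")
    case True
    then have "(sum ?p \<longlongrightarrow> flag_prob N b P A \<psi> flag) (finite_subsets_at_top ?H)"
      unfolding flag_prob_def using has_sum_def has_sum_infsum by blast
    then have "\<forall>\<^sub>F S in finite_subsets_at_top ?H. flag_prob N b P A \<psi> flag - \<eta> < sum ?p S"
      using assms by (intro order_tendstoD) auto
    moreover have "\<forall>\<^sub>F S in finite_subsets_at_top ?H. finite S \<and> S \<subseteq> ?H"
      by (rule eventually_finite_subsets_at_top_weakI) auto
    ultimately have "\<forall>\<^sub>F S in finite_subsets_at_top ?H.
        finite S \<and> S \<subseteq> ?H \<and> flag_prob N b P A \<psi> flag < sum ?p S + \<eta>"
      by eventually_elim auto
    then show ?thesis
      by (rule eventually_happens'[OF finite_subsets_at_top_neq_bot])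
  next
    \<comment> \<open>Without summability \<open>infsum\<close> has the default value 0, and the
      empty set suffices.\<close>
    case False
    then show ?thesis
      using assms by (intro exI[of _ "{}"]) (simp add: flag_prob_def infsum_not_exists)
  qed
  then obtain S where S: "finite S" "S \<subseteq> ?H" "flag_prob N b P A \<psi> flag < sum ?p S + \<eta>"
    by blast
  \<comment> \<open>Beyond the longest history in \<open>S\<close>, an element missing from the
    cut-off tree lies outside the tree altogether and has probability 0.\<close>
  have "sum ?p S \<le> sum ?p (flagged A flag t)" if "t > Max (insert 0 (length ` S))" for t
  proof -
    have short: "length h < t" if "h \<in> S" for h
      using \<open>t > Max (insert 0 (length ` S))\<close> that S(1) by simp
    have "?p h = 0" if "h \<in> S - S \<inter> flagged A flag t" for h
    proof -
      have "h \<notin> histories A (length h)"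
        using that S(2) short[of h] by (auto simp: flagged_def past_def)
      then show ?thesis
        by (simp add: history_prob_def branch_outside_histories)
    qed
    then have "sum ?p S = sum ?p (S \<inter> flagged A flag t)"
      using S(1) by (intro sum.mono_neutral_right) auto
    also have "\<dots> \<le> sum ?p (flagged A flag t)"
      by (intro sum_mono2) auto
    finally show ?thesis .
  qed
  then have "\<forall>\<^sub>F t in sequentially. sum ?p S \<le> sum ?p (flagged A flag t)"
    using eventually_gt_at_top by (rule eventually_mono[rotated])
  then show ?thesis
    by eventually_elim (use S(3) in linarith)
qed

lemma asking_le_expected:
  assumes "expected_queries N b P A \<psi> \<le> ennreal q" and "q \<ge> 0"
  shows "(\<Sum>h\<in>asking A t. history_prob N b P A \<psi> h) \<le> q"
proof -
  have "ennreal (\<Sum>h\<in>asking A t. history_prob N b P A \<psi> h) =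
      (\<Sum>h\<in>asking A t. ennreal (history_prob N b P A \<psi> h))"
    by simp
  also have "\<dots> \<le> expected_queries N b P A \<psi>"
    unfolding expected_queries_def
    by (subst nonneg_infsum_complete) (auto intro!: SUP_upper simp: asking_def)
  also have "\<dots> \<le> ennreal q"
    by (rule assms(1))
  finally show ?thesis
    using assms(2) by simp
qed

context
  assumes wf: "well_formed N b A" and lik: "likelihood N b P"
begin

lemma history_prob_Query:
  "program A h = Query \<Longrightarrow> history_prob N b P A \<psi> (0 # h) = history_prob N b P A \<psi> h"
  unfolding history_prob_def by (simp add: sq_norm_query lik)

lemma sum_history_prob_Measure:
  assumes "program A h = Measure Ks"
  shows "(\<Sum>k<length Ks. history_prob N b P A \<psi> (k # h)) = history_prob N b P A \<psi> h"
proof -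
  have "kraus_family (alg_labels N b A) Ks"
    using wf assms by (simp add: well_formed_def)
  then show ?thesis
    unfolding history_prob_def by (simp add: assms sq_norm_kraus)
qed

lemma sum_history_prob_leaves:
  "(\<Sum>h\<in>histories A t. history_prob N b P A \<psi> h) + (\<Sum>h\<in>halted A t. history_prob N b P A \<psi> h) =
     sq_norm (alg_labels N b A) \<psi>"
  using sum_leaves[of A "history_prob N b P A \<psi>" t, OF history_prob_Query sum_history_prob_Measure]
  by (simp add: history_prob_Nil)

text \<open>The potential is the remaining budget of \<open>q\<close> queries times the probability
  of the history. A query within the budget spends one unit, measurements conserve the potential,
  and truncated subtraction keeps it nonnegative once the budget is exhausted.\<close>

lemma sum_history_prob_asking_less:
  "(\<Sum>h\<in>{h \<in> asking A t. num_queries A h < q}. history_prob N b P A \<psi> h) \<le>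
     real q * sq_norm (alg_labels N b A) \<psi>"
proof -
  define V where "V h = real (q - num_queries A h) * history_prob N b P A \<psi> h" for h
  define W where "W h = - (if num_queries A h < q then history_prob N b P A \<psi> h else 0)" for h
  have "V (0 # h) \<le> V h + W h" if "program A h = Query" for h
  proof -
    have "V (0 # h) = real (q - Suc (num_queries A h)) * history_prob N b P A \<psi> h"
      using that by (simp add: V_def history_prob_Query)
    then show ?thesis
      by (auto simp: V_def W_def algebra_simps)
  qed
  moreover have "(\<Sum>k<length Ks. V (k # h)) \<le> V h" if "program A h = Measure Ks" for h Ks
    using sum_history_prob_Measure[OF that] that
    by (simp add: V_def sum_distrib_left[symmetric])
  ultimately have "(\<Sum>h\<in>histories A t. V h) + (\<Sum>h\<in>halted A t. V h) \<le> V [] + (\<Sum>h\<in>asking A t. W h)"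
    by (rule sum_leaves_le)
  moreover have "(\<Sum>h\<in>histories A t. V h) \<ge> 0" "(\<Sum>h\<in>halted A t. V h) \<ge> 0"
    by (auto simp: V_def intro!: sum_nonneg)
  moreover have "(\<Sum>h\<in>asking A t. W h) =
      - (\<Sum>h\<in>{h \<in> asking A t. num_queries A h < q}. history_prob N b P A \<psi> h)"
    by (simp add: W_def sum_negf sum.inter_filter)
  ultimately show ?thesis
    by (simp add: V_def history_prob_Nil)
qed

text \<open>A query after \<open>q\<close> earlier ones would have a child of the same probability
  with more than \<open>q\<close> queries, so its probability is 0.\<close>

lemma asking_le_queries:
  assumes "queries_at_most N b P A \<psi> q"
  shows "(\<Sum>h\<in>asking A t. history_prob N b P A \<psi> h) \<le> real q * sq_norm (alg_labels N b A) \<psi>"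
proof -
  have "history_prob N b P A \<psi> h = 0"
    if "h \<in> asking A t - {h \<in> asking A t. num_queries A h < q}" for h
  proof -
    have query: "program A h = Query" and "\<not> num_queries A (0 # h) \<le> q"
      using that by (auto simp: asking_def)
    then have "\<not> history_prob N b P A \<psi> (0 # h) > 0"
      using assms unfolding queries_at_most_def by blast
    then show ?thesis
      using history_prob_nonneg[of h] unfolding history_prob_Query[OF query] by linarith
  qed
  then have "(\<Sum>h\<in>asking A t. history_prob N b P A \<psi> h) =
      (\<Sum>h\<in>{h \<in> asking A t. num_queries A h < q}. history_prob N b P A \<psi> h)"
    by (intro sum.mono_neutral_right) auto
  then show ?thesis
    using sum_history_prob_asking_less by simp
qed

text \<open>Open and halted leaves share the total probability, and termination gives all of it to
  the halted ones in the limit.\<close>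

lemma sum_history_prob_histories_small:
  assumes "terminates N b P A \<psi>" and "\<eta> > 0"
  shows "\<forall>\<^sub>F t in sequentially. (\<Sum>h\<in>histories A t. history_prob N b P A \<psi> h) < \<eta>"
proof -
  have "\<eta> / 2 > 0"
    using assms(2) by simp
  from flag_prob_less_flagged[OF this, of True] flag_prob_less_flagged[OF this, of False]
  show ?thesis
  proof eventually_elim
    case (elim t)
    then show ?case
      using sum_history_prob_leaves[of t] assms(1)
      unfolding terminates_def sum_halted[of _ A t] by linarith
  qed
qed

end

end

section \<open>The hybrid argument for a family of marked oracles and one reference oracle\<close>

section \<open>Overlap with a reference run\<close>

context
  fixes N b :: nat and A :: algorithm and M :: "nat set" and P :: "nat \<Rightarrow> nat \<Rightarrow> real"
    and P0 :: "nat \<Rightarrow> real"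
  assumes wf: "well_formed N b A" and M: "finite M"
    and lik: "\<And>m. m \<in> M \<Longrightarrow> likelihood N b (P m)" and lik0: "likelihood N b P0"
    and agree: "\<And>m x. m \<in> M \<Longrightarrow> x \<in> {1..N} \<Longrightarrow> x \<noteq> m \<Longrightarrow> P m x = P0 x"
begin

private abbreviation (input) B :: "label set" where "B \<equiv> alg_labels N b A"

text \<open>The potential is the overlap summed over all marked values. Measurements conserve it,
  and a query costs at most \<open>W h\<close>. Since \<open>Q\<close> bounds the expected number of
  queries in each run, the costs add up to the stated term. The bound holds for all late cut-offs,
  since runs may be unbounded; \<open>\<eta>\<close> absorbs the branches still open.\<close>

lemma total_overlap_le:
  assumes halts: "\<And>m. m \<in> M \<Longrightarrow> terminates N b (P m) A (\<psi> m)" and halts0: "terminates N b P0 A \<phi>"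
    and asked: "\<And>m t. m \<in> M \<Longrightarrow>
      (\<Sum>h\<in>asking A t. history_prob N b (P m) A (\<psi> m) h) \<le> Q * sq_norm B (\<psi> m)"
    and asked0: "\<And>t. (\<Sum>h\<in>asking A t. history_prob N b P0 A \<phi> h) \<le> Q * sq_norm B \<phi>"
    and "c > 0" and "\<eta> > 0"
  shows "\<forall>\<^sub>F t in sequentially.
    (\<Sum>m\<in>M. Re (overlap B (\<psi> m) \<phi>)) \<le>
    (\<Sum>h\<in>halted A t. \<Sum>m\<in>M. Re (overlap B (branch N b (P m) A (\<psi> m) h) (branch N b P0 A \<phi> h))) +
      Q * (c * (\<Sum>m\<in>M. sq_norm B (\<psi> m)) + sq_norm B \<phi> / c) + \<eta>"
proof -
  define p where "p m = history_prob N b (P m) A (\<psi> m)" for m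
  define p0 where "p0 = history_prob N b P0 A \<phi>"
  define V where
    "V h = (\<Sum>m\<in>M. Re (overlap B (branch N b (P m) A (\<psi> m) h) (branch N b P0 A \<phi> h)))" for h
  define W where "W h = c * (\<Sum>m\<in>M. p m h) + p0 h / c" for h
  \<comment> \<open>The tree inequality bounds growth, so it is applied to the negated overlap. Each
    marked run is charged its full probability, but the reference run only once for all
    \<open>m\<close> together.\<close>
  have query: "- V (0 # h) \<le> - V h + W h" if "program A h = Query" for h
  proof -
    let ?\<psi> = "\<lambda>m. branch N b (P m) A (\<psi> m) h" and ?\<phi> = "branch N b P0 A \<phi> h"
    have "V h \<le> (\<Sum>m\<in>M. Re (overlap B (oracle_query b (P m) (?\<psi> m)) (oracle_query b P0 ?\<phi>)) +
        (c * sq_norm (latent B m) (?\<psi> m) + sq_norm (latent B m) ?\<phi> / c))"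
      unfolding V_def by (intro sum_mono overlap_query lik lik0 agree \<open>c > 0\<close>)
    also have "\<dots> = V (0 # h) + (c * (\<Sum>m\<in>M. sq_norm (latent B m) (?\<psi> m)) +
        (\<Sum>m\<in>M. sq_norm (latent B m) ?\<phi>) / c)"
      using that by (simp add: V_def sum.distrib sum_distrib_left sum_divide_distrib)
    also have "\<dots> \<le> V (0 # h) + W h"
      unfolding W_def p_def p0_def history_prob_def using \<open>c > 0\<close> M
      by (intro add_left_mono add_mono mult_left_mono divide_right_mono sum_mono
          sq_norm_latent_le sum_sq_norm_latent_le) auto
    finally show ?thesis by simp
  qed
  have measure: "(\<Sum>k<length Ks. - V (k # h)) \<le> - V h" if "program A h = Measure Ks" for h Ks
  proof -
    have kraus: "kraus_family B Ks"
      using wf that by (simp add: well_formed_def)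
    have "(\<Sum>k<length Ks. V (k # h)) =
      (\<Sum>m\<in>M. \<Sum>k<length Ks. Re (overlap B (apply_operator B (Ks ! k) (branch N b (P m) A (\<psi> m) h))
        (apply_operator B (Ks ! k) (branch N b P0 A \<phi> h))))"
      unfolding V_def by (subst sum.swap) (simp add: that)
    also have "\<dots> = V h"
      unfolding V_def Re_sum[symmetric] by (simp add: overlap_kraus kraus)
    finally show ?thesis by (simp add: sum_negf)
  qed
  have leaves: "V [] \<le> (\<Sum>h\<in>halted A t. V h) + (\<Sum>h\<in>histories A t. V h) + (\<Sum>h\<in>asking A t. W h)" for t
    using sum_leaves_le[of A "\<lambda>h. - V h" W t, OF query measure] by (simp add: sum_negf)
  have asking: "(\<Sum>h\<in>asking A t. W h) \<le> Q * (c * (\<Sum>m\<in>M. sq_norm B (\<psi> m)) + sq_norm B \<phi> / c)" for t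
  proof -
    have "(\<Sum>h\<in>asking A t. W h) = c * (\<Sum>m\<in>M. \<Sum>h\<in>asking A t. p m h) + (\<Sum>h\<in>asking A t. p0 h) / c"
      by (simp add: W_def sum.distrib sum_distrib_left sum_divide_distrib sum.swap[of _ "asking A t" M])
    also have "\<dots> \<le> c * (\<Sum>m\<in>M. Q * sq_norm B (\<psi> m)) + Q * sq_norm B \<phi> / c"
      unfolding p_def p0_def using \<open>c > 0\<close>
      by (intro add_mono mult_left_mono divide_right_mono sum_mono asked asked0) auto
    finally show ?thesis
      by (simp add: sum_distrib_left[symmetric] algebra_simps)
  qed
  \<comment> \<open>One share of \<open>\<eta>\<close> for each marked value; the added 1 covers
    empty \<open>M\<close>.\<close>
  define \<epsilon> where "\<epsilon> = \<eta> / (real (card M) + 1)"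
  have "\<epsilon> > 0"
    using \<open>\<eta> > 0\<close> by (simp add: \<epsilon>_def)
  have "\<forall>\<^sub>F t in sequentially. \<forall>m\<in>M. (\<Sum>h\<in>histories A t. p m h) < \<epsilon>"
    unfolding p_def
    by (intro eventually_ball_finite M ballI sum_history_prob_histories_small wf lik halts \<open>\<epsilon> > 0\<close>)
  moreover have "\<forall>\<^sub>F t in sequentially. (\<Sum>h\<in>histories A t. p0 h) < \<epsilon>"
    unfolding p0_def by (intro sum_history_prob_histories_small wf lik0 halts0 \<open>\<epsilon> > 0\<close>)
  ultimately show ?thesis
  proof eventually_elim
    case (elim t)
    have "(\<Sum>h\<in>histories A t. V h) \<le> (\<Sum>h\<in>histories A t. \<Sum>m\<in>M. (p m h + p0 h) / 2)"
      unfolding V_def p_def p0_def history_prob_def by (intro sum_mono overlap_le)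
    also have "\<dots> = (\<Sum>m\<in>M. ((\<Sum>h\<in>histories A t. p m h) + (\<Sum>h\<in>histories A t. p0 h)) / 2)"
      by (subst sum.swap) (simp add: sum.distrib add_divide_distrib sum_divide_distrib)
    also have "\<dots> \<le> (\<Sum>m\<in>M. \<epsilon>)"
      using elim by (intro sum_mono) (auto intro: order.trans[OF divide_right_mono[OF add_mono]])
    also have "\<dots> \<le> \<eta>"
      using \<open>\<eta> > 0\<close> by (simp add: \<epsilon>_def field_simps)
    finally show ?case
      using leaves[of t] asking[of t] by (simp add: V_def)
  qed
qed

text \<open>The form for a task in which every halting branch has a relative overlap of at most
  \<open>g\<close>: the initial total can exceed the fraction \<open>g\<close> of the total mass
  only by the cost of the queries.\<close>

lemma total_overlap_le_halting:
  assumes halts: "\<And>m. m \<in> M \<Longrightarrow> terminates N b (P m) A (\<psi> m)" and halts0: "terminates N b P0 A \<phi>"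
    and asked: "\<And>m t. m \<in> M \<Longrightarrow>
      (\<Sum>h\<in>asking A t. history_prob N b (P m) A (\<psi> m) h) \<le> Q * sq_norm B (\<psi> m)"
    and asked0: "\<And>t. (\<Sum>h\<in>asking A t. history_prob N b P0 A \<phi> h) \<le> Q * sq_norm B \<phi>"
    and "c > 0" and "g \<ge> 0"
    and final: "\<And>m h flag. m \<in> M \<Longrightarrow> program A h = Halt flag \<Longrightarrow>
      Re (overlap B (branch N b (P m) A (\<psi> m) h) (branch N b P0 A \<phi> h)) \<le>
        g * ((history_prob N b (P m) A (\<psi> m) h + history_prob N b P0 A \<phi> h) / 2)"
  shows "(\<Sum>m\<in>M. Re (overlap B (\<psi> m) \<phi>)) \<le>
    g * (\<Sum>m\<in>M. (sq_norm B (\<psi> m) + sq_norm B \<phi>) / 2) +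
      Q * (c * (\<Sum>m\<in>M. sq_norm B (\<psi> m)) + sq_norm B \<phi> / c)"
proof (rule field_le_epsilon)
  fix \<eta> :: real assume "\<eta> > 0"
  from eventually_happens'[OF sequentially_bot total_overlap_le[OF halts halts0 asked asked0 \<open>c > 0\<close> this]]
  obtain t where t: "(\<Sum>m\<in>M. Re (overlap B (\<psi> m) \<phi>)) \<le>
    (\<Sum>h\<in>halted A t. \<Sum>m\<in>M. Re (overlap B (branch N b (P m) A (\<psi> m) h) (branch N b P0 A \<phi> h))) +
      Q * (c * (\<Sum>m\<in>M. sq_norm B (\<psi> m)) + sq_norm B \<phi> / c) + \<eta>"
    by blast
  have le: "(\<Sum>h\<in>halted A t. history_prob N b P' A \<psi>' h) \<le> sq_norm B \<psi>'"
    if "likelihood N b P'" for P' \<psi>'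
    using sum_history_prob_leaves[OF wf that, of \<psi>' t]
    by (smt (verit) history_prob_nonneg sum_nonneg)
  have "(\<Sum>h\<in>halted A t. \<Sum>m\<in>M. Re (overlap B (branch N b (P m) A (\<psi> m) h) (branch N b P0 A \<phi> h))) \<le>
    (\<Sum>h\<in>halted A t. \<Sum>m\<in>M. g * ((history_prob N b (P m) A (\<psi> m) h + history_prob N b P0 A \<phi> h) / 2))"
  proof (intro sum_mono)
    fix h m assume "h \<in> halted A t" "m \<in> M"
    then obtain flag where "program A h = Halt flag"
      by (auto simp: halted_def)
    with \<open>m \<in> M\<close> show "Re (overlap B (branch N b (P m) A (\<psi> m) h) (branch N b P0 A \<phi> h)) \<le>
        g * ((history_prob N b (P m) A (\<psi> m) h + history_prob N b P0 A \<phi> h) / 2)"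
      by (rule final)
  qed
  also have "\<dots> = g * (\<Sum>m\<in>M. ((\<Sum>h\<in>halted A t. history_prob N b (P m) A (\<psi> m) h) +
      (\<Sum>h\<in>halted A t. history_prob N b P0 A \<phi> h)) / 2)"
    by (subst sum.swap)
      (simp add: sum.distrib add_divide_distrib sum_divide_distrib sum_distrib_left distrib_left mult_ac)
  also have "\<dots> \<le> g * (\<Sum>m\<in>M. (sq_norm B (\<psi> m) + sq_norm B \<phi>) / 2)"
    by (intro mult_left_mono sum_mono divide_right_mono add_mono le lik lik0 \<open>g \<ge> 0\<close>) auto
  finally show "(\<Sum>m\<in>M. Re (overlap B (\<psi> m) \<phi>)) \<le>
    g * (\<Sum>m\<in>M. (sq_norm B (\<psi> m) + sq_norm B \<phi>) / 2) +
      Q * (c * (\<Sum>m\<in>M. sq_norm B (\<psi> m)) + sq_norm B \<phi> / c) + \<eta>"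
    using t by linarith
qed

text \<open>All runs start in the same state, so the distances to the reference run start at 0 and
  grow only by queries. A marked run can carry weight at \<open>m\<close> only through this distance
  or through the weight at \<open>m\<close> of the reference run, and the latter weights sum to at
  most the norm of the input.\<close>

lemma total_latent_mass_le:
  "(\<Sum>m\<in>M. \<Sum>h\<in>{h \<in> halted A t. num_queries A h \<le> T}.
      sq_norm (latent B m) (branch N b (P m) A \<phi> h)) \<le>
    (16 * 2 ^ T * real T + 2) * sq_norm B \<phi>"
proof -
  define p0 where "p0 = history_prob N b P0 A \<phi>"
  define D where "D m h = sq_norm B (\<lambda>i. branch N b (P m) A \<phi> h i - branch N b P0 A \<phi> h i)" for m h
  \<comment> \<open>One factor 2 for each remaining query absorbs the doubling in
    \<open>sq_norm_query_diff\<close>; histories with more than \<open>T\<close> queries are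
    dropped.\<close>
  define w :: "nat list \<Rightarrow> real" where
    "w h = (if num_queries A h \<le> T then 2 ^ (T - num_queries A h) else 0)" for h
  define V where "V h = w h * (\<Sum>m\<in>M. D m h)" for h
  define W where "W h = (if num_queries A h < T then 8 * 2 ^ T * p0 h else 0)" for h
  have D_nonneg: "D m h \<ge> 0" for m h
    by (simp add: D_def)
  have V_nonneg: "V h \<ge> 0" for h
    by (simp add: V_def w_def sum_nonneg D_nonneg)
  have p0_nonneg: "p0 h \<ge> 0" for h
    by (simp add: p0_def)
  have query: "V (0 # h) \<le> V h + W h" if q: "program A h = Query" for h
  proof (cases "num_queries A h < T")
    case True
    define n where "n = T - Suc (num_queries A h)"
    have n: "T - num_queries A h = Suc n" "n \<le> T"
      using True by (auto simp: n_def)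
    have "(\<Sum>m\<in>M. D m (0 # h)) \<le>
        (\<Sum>m\<in>M. 2 * D m h + 8 * sq_norm (latent B m) (branch N b P0 A \<phi> h))"
      unfolding D_def branch_Query[of A h, OF q]
      by (intro sum_mono sq_norm_query_diff lik lik0 agree)
    also have "\<dots> = 2 * (\<Sum>m\<in>M. D m h) + 8 * (\<Sum>m\<in>M. sq_norm (latent B m) (branch N b P0 A \<phi> h))"
      by (simp add: sum.distrib sum_distrib_left)
    also have "\<dots> \<le> 2 * (\<Sum>m\<in>M. D m h) + 8 * p0 h"
      using sum_sq_norm_latent_le[of B M "branch N b P0 A \<phi> h"] M
      by (simp add: p0_def history_prob_def)
    finally have "2 ^ n * (\<Sum>m\<in>M. D m (0 # h)) \<le> 2 ^ n * (2 * (\<Sum>m\<in>M. D m h) + 8 * p0 h)"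
      by (intro mult_left_mono) auto
    also have "\<dots> \<le> 2 ^ Suc n * (\<Sum>m\<in>M. D m h) + 2 ^ T * (8 * p0 h)"
      using power_increasing[OF n(2), of "2 :: real"] p0_nonneg[of h]
        mult_right_mono[of "2 ^ n :: real" "2 ^ T" "8 * p0 h"]
      by (simp add: algebra_simps)
    finally show ?thesis
      using True q n by (simp add: V_def w_def W_def n_def[symmetric])
  next
    case False
    then show ?thesis
      using q V_nonneg[of h] by (simp add: V_def w_def W_def)
  qed
  have measure: "(\<Sum>k<length Ks. V (k # h)) \<le> V h" if q: "program A h = Measure Ks" for h Ks
  proof -
    have kraus: "kraus_family B Ks"
      using wf q by (simp add: well_formed_def)
    have "D m (k # h) = sq_norm B (apply_operator B (Ks ! k)
        (\<lambda>i. branch N b (P m) A \<phi> h i - branch N b P0 A \<phi> h i))" if "k < length Ks" for k m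
      unfolding D_def sq_norm_def using that
      by (intro sum.cong) (simp_all add: q apply_operator_def sum_subtractf algebra_simps)
    then have "(\<Sum>k<length Ks. D m (k # h)) = D m h" for m
      using sq_norm_kraus[OF _ kraus, of "\<lambda>i. branch N b (P m) A \<phi> h i - branch N b P0 A \<phi> h i"]
      by (simp add: D_def[of m h])
    then have "(\<Sum>k<length Ks. \<Sum>m\<in>M. D m (k # h)) = (\<Sum>m\<in>M. D m h)"
      by (subst sum.swap) simp
    moreover have "w (k # h) = w h" for k
      by (simp add: w_def q)
    ultimately show ?thesis
      by (simp add: V_def sum_distrib_left[symmetric])
  qed
  have "(\<Sum>h\<in>histories A t. V h) + (\<Sum>h\<in>halted A t. V h) \<le> V [] + (\<Sum>h\<in>asking A t. W h)"
    by (rule sum_leaves_le[OF query measure])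
  moreover have "V [] = 0"
    by (simp add: V_def D_def)
  moreover have "(\<Sum>h\<in>histories A t. V h) \<ge> 0"
    by (intro sum_nonneg V_nonneg)
  moreover have "(\<Sum>h\<in>asking A t. W h) \<le> 8 * 2 ^ T * (real T * sq_norm B \<phi>)"
  proof -
    have "(\<Sum>h\<in>asking A t. W h) = 8 * 2 ^ T * (\<Sum>h\<in>{h \<in> asking A t. num_queries A h < T}. p0 h)"
      by (simp add: W_def sum_distrib_left sum.inter_filter if_distrib[of "\<lambda>x. 8 * 2 ^ T * x"] cong: if_cong)
    then show ?thesis
      using sum_history_prob_asking_less[OF wf lik0, where \<psi> = \<phi> and t = t and q = T]
      by (simp add: p0_def)
  qed
  ultimately have halted_V: "(\<Sum>h\<in>halted A t. V h) \<le> 8 * 2 ^ T * (real T * sq_norm B \<phi>)"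
    by linarith
  have halted_p0: "(\<Sum>h\<in>halted A t. p0 h) \<le> sq_norm B \<phi>"
    using sum_history_prob_leaves[OF wf lik0, of \<phi> t] sum_nonneg[of "histories A t" p0] p0_nonneg
    unfolding p0_def by simp
  have "(\<Sum>m\<in>M. sq_norm (latent B m) (branch N b (P m) A \<phi> h)) \<le> 2 * V h + 2 * p0 h"
    if "num_queries A h \<le> T" for h
  proof -
    let ?\<psi> = "\<lambda>m. branch N b (P m) A \<phi> h" and ?\<phi> = "branch N b P0 A \<phi> h"
    have "(\<Sum>m\<in>M. sq_norm (latent B m) (?\<psi> m)) \<le>
        (\<Sum>m\<in>M. 2 * D m h + 2 * sq_norm (latent B m) ?\<phi>)"
    proof (rule sum_mono)
      fix m
      show "sq_norm (latent B m) (?\<psi> m) \<le> 2 * D m h + 2 * sq_norm (latent B m) ?\<phi>"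
        using sq_norm_add_le[of "latent B m" "\<lambda>i. ?\<psi> m i - ?\<phi> i" ?\<phi>]
          sq_norm_latent_le[of B m "\<lambda>i. ?\<psi> m i - ?\<phi> i"]
        by (simp add: D_def)
    qed
    also have "\<dots> = 2 * (\<Sum>m\<in>M. D m h) + 2 * (\<Sum>m\<in>M. sq_norm (latent B m) ?\<phi>)"
      by (simp add: sum.distrib sum_distrib_left)
    also have "\<dots> \<le> 2 * V h + 2 * p0 h"
    proof -
      \<comment> \<open>The weight is at least 1 within the budget, so \<open>V\<close> dominates
        the plain distance.\<close>
      have "1 * (\<Sum>m\<in>M. D m h) \<le> w h * (\<Sum>m\<in>M. D m h)"
        using that by (intro mult_right_mono sum_nonneg D_nonneg) (simp add: w_def)
      then show ?thesis
        using sum_sq_norm_latent_le[of B M ?\<phi>] M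
        by (simp add: V_def p0_def history_prob_def)
    qed
    finally show ?thesis .
  qed
  then have "(\<Sum>h\<in>{h \<in> halted A t. num_queries A h \<le> T}. \<Sum>m\<in>M.
      sq_norm (latent B m) (branch N b (P m) A \<phi> h)) \<le>
      (\<Sum>h\<in>{h \<in> halted A t. num_queries A h \<le> T}. 2 * V h + 2 * p0 h)"
    by (intro sum_mono) auto
  also have "\<dots> \<le> (\<Sum>h\<in>halted A t. 2 * V h + 2 * p0 h)"
    using V_nonneg p0_nonneg by (intro sum_mono2) auto
  also have "\<dots> = 2 * (\<Sum>h\<in>halted A t. V h) + 2 * (\<Sum>h\<in>halted A t. p0 h)"
    by (simp add: sum.distrib sum_distrib_left)
  also have "\<dots> \<le> (16 * 2 ^ T * real T + 2) * sq_norm B \<phi>"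
    using halted_V halted_p0 by (simp add: algebra_simps)
  finally show ?thesis
    by (subst sum.swap)
qed

end


section \<open>Input states, larger work registers, and the marked problems\<close>

section \<open>Input states and problems\<close>

lemma overlap_input_state:
  assumes "W > 0"
  shows "overlap (labels N b W) (input_state \<alpha> N) (input_state \<beta> N) = (\<Sum>x=1..N. cnj (\<alpha> x) * \<beta> x)"
proof -
  have "overlap (labels N b W) (input_state \<alpha> N) (input_state \<beta> N) =
      (\<Sum>i\<in>(\<lambda>x. (x, 0, 0)) ` {1..N}. cnj (input_state \<alpha> N i) * input_state \<beta> N i)"
    unfolding overlap_def using assms
    by (intro sum.mono_neutral_right) (auto simp: labels_def input_state_def split: if_splits)
  also have "\<dots> = (\<Sum>x=1..N. cnj (\<alpha> x) * \<beta> x)"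
    by (subst sum.reindex) (auto simp: inj_on_def input_state_def)
  finally show ?thesis .
qed

lemma sq_norm_input_state:
  assumes "W > 0"
  shows "sq_norm (labels N b W) (input_state \<alpha> N) = (\<Sum>x=1..N. (cmod (\<alpha> x))\<^sup>2)"
  using overlap_input_state[OF assms, of N b \<alpha> \<alpha>]
  by (simp add: overlap_self complex_mult_cnj mult.commute[of "cnj _"] cmod_power2
      flip: of_real_sum of_real_add of_real_power)

text \<open>With \<open>labels_extend\<close>, this makes norms and overlaps of states left by the
  update the same in the larger work register of the undoing algorithm.\<close>

lemma branch_outside_work:
  assumes "\<And>x y w. w \<ge> work_dim A \<Longrightarrow> \<psi> (x, y, w) = 0" and "w \<ge> work_dim A"
  shows "branch N b P A \<psi> h (x, y, w) = 0"
  using assms(2)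
proof (induction h arbitrary: x y w)
  case (Cons k h)
  then show ?case
    by (cases "program A h") (auto simp: oracle_query_def apply_operator_def labels_def)
qed (use assms(1) in simp)

lemma labels_extend:
  assumes "W \<le> W'" and "\<And>x y w. w \<ge> W \<Longrightarrow> \<psi> (x, y, w) = 0"
  shows "sq_norm (labels N b W') \<psi> = sq_norm (labels N b W) \<psi>"
    and "overlap (labels N b W') \<psi> \<phi> = overlap (labels N b W) \<psi> \<phi>"
proof -
  have zero: "\<psi> i = 0" if "i \<in> labels N b W' - labels N b W" for i
    using that assms(2) by (cases i) (auto simp: labels_def)
  have sub: "labels N b W \<subseteq> labels N b W'"
    using assms(1) by (auto simp: labels_def)
  show "sq_norm (labels N b W') \<psi> = sq_norm (labels N b W) \<psi>"
    unfolding sq_norm_def using sub zero by (intro sum.mono_neutral_right) auto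
  show "overlap (labels N b W') \<psi> \<phi> = overlap (labels N b W) \<psi> \<phi>"
    unfolding overlap_def using sub zero by (intro sum.mono_neutral_right) auto
qed

lemma holds_state_cong:
  assumes "\<And>x. x \<in> {1..N} \<Longrightarrow> \<alpha> x = \<beta> x" and "holds_state (labels N b W) \<alpha> \<psi>"
  shows "holds_state (labels N b W) \<beta> \<psi>"
proof -
  obtain \<phi> where "\<forall>(x, y, w)\<in>labels N b W. \<psi> (x, y, w) = \<alpha> x * \<phi> (y, w)"
    using assms(2) unfolding holds_state_def by blast
  then have "\<forall>(x, y, w)\<in>labels N b W. \<psi> (x, y, w) = \<beta> x * \<phi> (y, w)"
    using assms(1) by (auto simp: labels_def)
  then show ?thesis
    unfolding holds_state_def by blast
qed

subsection \<open>The posterior separates from a fixed reference state\<close>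

text \<open>Against the reference problem with constant likelihood \<open>1/2\<close> and input \<open>|1\<rangle>\<close>, where the update is
  the identity, the problem with marked \<open>m\<close> has overlap \<open>1/5\<close> before and \<open>1/7\<close> after the update. The
  weights \<open>1/25\<close> and \<open>24/25\<close> make the evidence \<open>49/50\<close>, so that both overlaps are rational.\<close>

definition half_likelihood :: "nat \<Rightarrow> real" where
  "half_likelihood x = 1 / 2"

definition marked_likelihood :: "nat \<Rightarrow> nat \<Rightarrow> real" where
  "marked_likelihood m x = (if x = m then 1 else 1 / 2)"

definition first_state :: "nat \<Rightarrow> real" where
  "first_state x = (if x = 1 then 1 else 0)"

definition marked_prior :: "nat \<Rightarrow> nat \<Rightarrow> real" where
  "marked_prior m x = (if x = 1 then 1 / 5 else if x = m then sqrt 24 / 5 else 0)"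

text \<open>The posterior weights are 1/50 and 24/25 divided by the evidence 49/50, that is, 1/49
  and 48/49.\<close>

definition marked_posterior :: "nat \<Rightarrow> nat \<Rightarrow> real" where
  "marked_posterior m x = (if x = 1 then 1 / 7 else if x = m then sqrt 48 / 7 else 0)"

lemma sum_first:
  fixes f :: "nat \<Rightarrow> real"
  assumes "N \<ge> 1" and "\<And>x. x \<in> {1..N} \<Longrightarrow> x \<noteq> 1 \<Longrightarrow> f x = 0"
  shows "(\<Sum>x=1..N. f x) = f 1"
  using assms by (subst sum.mono_neutral_right[of "{1..N}" "{1}"]) auto

lemma sum_first_marked:
  fixes f :: "nat \<Rightarrow> real"
  assumes "m \<in> {2..N}" and "\<And>x. x \<in> {1..N} \<Longrightarrow> x \<noteq> 1 \<Longrightarrow> x \<noteq> m \<Longrightarrow> f x = 0"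
  shows "(\<Sum>x=1..N. f x) = f 1 + f m"
  using assms by (subst sum.mono_neutral_right[of "{1..N}" "{1, m}"]) auto

text \<open>The likelihood 1/2 takes up one fractional bit, which explains the hypothesis on
  \<open>b\<close> in the bounds for undoing and for expected queries.\<close>

lemma half_dyadic:
  assumes "b \<ge> 1"
  shows "\<exists>k::nat. k \<le> 2 ^ b \<and> (1 / 2 :: real) = real k / 2 ^ b"
proof -
  obtain c where "b = Suc c"
    using assms by (cases b) auto
  then show ?thesis
    by (intro exI[of _ "2 ^ c"]) simp
qed

lemma one_dyadic: "\<exists>k::nat. k \<le> 2 ^ b \<and> (1 :: real) = real k / 2 ^ b"
  by (intro exI[of _ "2 ^ b"]) simp

lemma zero_dyadic: "\<exists>k::nat. k \<le> 2 ^ b \<and> (0 :: real) = real k / 2 ^ b"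
  by (intro exI[of _ 0]) simp

lemma likelihood_half: "b \<ge> 1 \<Longrightarrow> likelihood N b half_likelihood"
  unfolding likelihood_def half_likelihood_def using half_dyadic by blast

lemma likelihood_marked: "b \<ge> 1 \<Longrightarrow> likelihood N b (marked_likelihood m)"
  unfolding likelihood_def marked_likelihood_def using half_dyadic one_dyadic by simp

lemma sum_first_state:
  assumes "N \<ge> 1"
  shows "(\<Sum>x=1..N. (first_state x)\<^sup>2) = 1" and "(\<Sum>x=1..N. r x * first_state x) = r 1"
  using assms by (subst sum_first; simp add: first_state_def)+

lemma sum_marked_prior: "m \<in> {2..N} \<Longrightarrow> (\<Sum>x=1..N. (marked_prior m x)\<^sup>2) = 1"
  by (subst sum_first_marked) (auto simp: marked_prior_def power_divide)

lemma sum_marked_posterior: "m \<in> {2..N} \<Longrightarrow> (\<Sum>x=1..N. (marked_posterior m x)\<^sup>2) = 1"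
  by (subst sum_first_marked) (auto simp: marked_posterior_def power_divide)

lemma evidence_half:
  assumes "N \<ge> 1"
  shows "evidence N half_likelihood (\<lambda>x. of_real (first_state x)) = 1 / 2"
  unfolding evidence_def using assms
  by (subst sum_first) (auto simp: first_state_def half_likelihood_def)

lemma evidence_marked:
  assumes "m \<in> {2..N}"
  shows "evidence N (marked_likelihood m) (\<lambda>x. of_real (marked_prior m x)) = 49 / 50"
  unfolding evidence_def using assms
  by (subst sum_first_marked) (auto simp: marked_prior_def marked_likelihood_def power_divide)

lemma half_valid:
  assumes "N \<ge> 1" and "b N \<ge> 1"
  shows "(N, 1, half_likelihood, \<lambda>x. of_real (first_state x)) \<in> valid_problems b"
  using assms sum_first_state(1)[of N] evidence_half[of N] likelihood_half[of "b N" N]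
  by (auto simp: valid_problems_def half_likelihood_def)

lemma marked_valid:
  assumes "m \<in> {2..N}" and "b N \<ge> 1"
  shows "(N, 1, marked_likelihood m, \<lambda>x. of_real (marked_prior m x)) \<in> valid_problems b"
  using assms sum_marked_prior[of m N] evidence_marked[of m N] likelihood_marked[of "b N" N m]
  by (auto simp: valid_problems_def marked_likelihood_def)

lemma updated_half:
  assumes "N \<ge> 1"
  shows "updated N half_likelihood (\<lambda>x. of_real (first_state x)) x = of_real (first_state x)"
  by (simp add: updated_def evidence_half[OF assms] half_likelihood_def)

lemma updated_marked:
  assumes "m \<in> {2..N}" and "x \<in> {1..N}"
  shows "updated N (marked_likelihood m) (\<lambda>x. of_real (marked_prior m x)) x =
    of_real (marked_posterior m x)"
proof -
  \<comment> \<open>The quotient of the radicands is 25/49, a perfect square; the analogous quotient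
    with 24 is 48 times this square.\<close>
  have "sqrt (1 / 2) / sqrt (49 / 50) = sqrt ((5 / 7)\<^sup>2)"
    unfolding real_sqrt_divide[symmetric] by (rule arg_cong[of _ _ sqrt]) (simp add: power2_eq_square)
  then have first: "sqrt (1 / 2) / sqrt (49 / 50) = 5 / 7"
    by simp
  have "sqrt 24 / sqrt (49 / 50) = sqrt (48 * (5 / 7)\<^sup>2)"
    unfolding real_sqrt_divide[symmetric] by (rule arg_cong[of _ _ sqrt]) (simp add: power2_eq_square)
  then have marked: "sqrt 24 / sqrt (49 / 50) = sqrt 48 * (5 / 7)"
    by (simp add: real_sqrt_mult)
  have "marked_prior m x * sqrt (marked_likelihood m x) / sqrt (49 / 50) = marked_posterior m x"
  proof (cases "x = 1")
    case True
    then have "marked_prior m x * sqrt (marked_likelihood m x) / sqrt (49 / 50) =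
        1 / 5 * (sqrt (1 / 2) / sqrt (49 / 50))"
      using assms by (simp add: marked_prior_def marked_likelihood_def)
    also have "\<dots> = marked_posterior m x"
      unfolding first using True by (simp add: marked_posterior_def)
    finally show ?thesis .
  next
    case False
    then have "marked_prior m x * sqrt (marked_likelihood m x) / sqrt (49 / 50) =
        (if x = m then 1 / 5 * (sqrt 24 / sqrt (49 / 50)) else 0)"
      using assms by (simp add: marked_prior_def marked_likelihood_def)
    also have "\<dots> = marked_posterior m x"
      unfolding marked using False by (simp add: marked_posterior_def)
    finally show ?thesis .
  qed
  then show ?thesis
    unfolding updated_def evidence_marked[OF assms(1)]
    by (simp only: flip: of_real_mult of_real_divide)
qed

lemma overlap_marked_input:
  assumes "m \<in> {2..N}" and "W > 0"
  shows "overlap (labels N b W) (input_state (\<lambda>x. of_real (marked_prior m x)) N)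
    (input_state (\<lambda>x. of_real (first_state x)) N) = 1 / 5"
proof -
  have "overlap (labels N b W) (input_state (\<lambda>x. of_real (marked_prior m x)) N)
    (input_state (\<lambda>x. of_real (first_state x)) N) =
      of_real (\<Sum>x=1..N. marked_prior m x * first_state x)"
    using assms by (simp add: overlap_input_state)
  also have "(\<Sum>x=1..N. marked_prior m x * first_state x) = 1 / 5"
    using assms by (subst sum_first_state(2)) (auto simp: marked_prior_def)
  finally show ?thesis by simp
qed

lemma overlap_marked_prior:
  assumes "m \<in> {2..N}"
    and "holds_state (labels N b W) (\<lambda>x. of_real (marked_prior m x)) \<psi>"
    and "holds_state (labels N b W) (\<lambda>x. of_real (first_state x)) \<phi>"
  shows "Re (overlap (labels N b W) \<psi> \<phi>) \<le>
    1 / 5 * ((sq_norm (labels N b W) \<psi> + sq_norm (labels N b W) \<phi>) / 2)"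
proof -
  have sum: "(\<Sum>x=1..N. marked_prior m x * first_state x) = 1 / 5"
    using assms(1) by (subst sum_first_state(2)) (auto simp: marked_prior_def)
  show ?thesis
    using overlap_holds_state[OF assms(2,3) sum_marked_prior[OF assms(1)] sum_first_state(1), unfolded sum]
      assms(1) by simp
qed

lemma overlap_marked_posterior:
  assumes "m \<in> {2..N}"
    and "holds_state (labels N b W)
      (updated N (marked_likelihood m) (\<lambda>x. of_real (marked_prior m x))) \<psi>"
    and "holds_state (labels N b W) (updated N half_likelihood (\<lambda>x. of_real (first_state x))) \<phi>"
  shows "Re (overlap (labels N b W) \<psi> \<phi>) \<le>
    1 / 7 * ((sq_norm (labels N b W) \<psi> + sq_norm (labels N b W) \<phi>) / 2)"
proof -
  have \<psi>: "holds_state (labels N b W) (\<lambda>x. of_real (marked_posterior m x)) \<psi>"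
    by (rule holds_state_cong[OF updated_marked[OF assms(1)] assms(2)])
  have \<phi>: "holds_state (labels N b W) (\<lambda>x. of_real (first_state x)) \<phi>"
    using assms(1) by (intro holds_state_cong[OF updated_half assms(3)]) auto
  have sum: "(\<Sum>x=1..N. marked_posterior m x * first_state x) = 1 / 7"
    using assms(1) by (subst sum_first_state(2)) (auto simp: marked_posterior_def)
  show ?thesis
    using overlap_holds_state[OF \<psi> \<phi> sum_marked_posterior[OF assms(1)] sum_first_state(1), unfolded sum]
      assms(1) by simp
qed

abbreviation first_input :: "nat \<Rightarrow> state" where
  "first_input N \<equiv> input_state (\<lambda>x. of_real (first_state x)) N"

abbreviation marked_input :: "nat \<Rightarrow> nat \<Rightarrow> state" where
  "marked_input N m \<equiv> input_state (\<lambda>x. of_real (marked_prior m x)) N"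

lemma sq_norm_first_input: "N \<ge> 1 \<Longrightarrow> W > 0 \<Longrightarrow> sq_norm (labels N b W) (first_input N) = 1"
  using sum_first_state(1)[of N] by (simp add: sq_norm_input_state)

lemma sq_norm_marked_input: "m \<in> {2..N} \<Longrightarrow> W > 0 \<Longrightarrow> sq_norm (labels N b W) (marked_input N m) = 1"
  using sum_marked_prior[of m N] by (simp add: sq_norm_input_state)


section \<open>Quantitative bounds for fixed N\<close>

section \<open>The three lower bounds\<close>

text \<open>With \<open>K = N - 1\<close> marked values, the total overlap must fall from
  \<open>K / 5\<close> to at most \<open>K / 7\<close>, while \<open>Q\<close> expected queries can
  lower it by at most \<open>2 * Q * sqrt K\<close>. The difference \<open>2 * K / 35\<close> yields
  the constant 35.\<close>

lemma expected_queries_lower_bound: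
  assumes update: "update_with_expected_queries b I q" and "b N \<ge> 1" and "N \<ge> 2"
  shows "sqrt (real (N - 1)) \<le> 35 * max (q N) 0"
proof -
  define K where "K = real (N - 1)"
  \<comment> \<open>\<open>ennreal\<close> sends negative numbers to 0.\<close>
  define Q where "Q = max (q N) 0"
  define A where "A = I N"
  have "K > 0"
    using \<open>N \<ge> 2\<close> by (simp add: K_def)
  have wf: "well_formed N (b N) A"
    using update \<open>N \<ge> 2\<close> by (simp add: update_with_expected_queries_def A_def)
  then have W: "work_dim A > 0"
    by (simp add: well_formed_def)
  have run: "terminates N (b N) P A (input_state \<alpha> N)"
    "expected_queries N (b N) P A (input_state \<alpha> N) \<le> ennreal (q N)"
    "\<And>h flag. program A h = Halt flag \<Longrightarrow>
      holds_state (alg_labels N (b N) A) (updated N P \<alpha>) (branch N (b N) P A (input_state \<alpha> N) h)"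
    if "(N, 1, P, \<alpha>) \<in> valid_problems b" for P \<alpha>
    using update that unfolding update_with_expected_queries_def A_def by blast+
  have asked: "(\<Sum>h\<in>asking A t. history_prob N (b N) P A (input_state \<alpha> N) h) \<le> Q"
    if "(N, 1, P, \<alpha>) \<in> valid_problems b" for P \<alpha> t
    using asking_le_expected[of N "b N" P A "input_state \<alpha> N" Q t] run(2)[OF that]
    by (auto simp: Q_def max_def ennreal_neg split: if_splits)
  have valid: "(N, 1, marked_likelihood m, \<lambda>x. of_real (marked_prior m x)) \<in> valid_problems b"
    if "m \<in> {2..N}" for m
    using that \<open>b N \<ge> 1\<close> by (rule marked_valid)
  have valid0: "(N, 1, half_likelihood, \<lambda>x. of_real (first_state x)) \<in> valid_problems b"
    using \<open>N \<ge> 2\<close> \<open>b N \<ge> 1\<close> by (intro half_valid) auto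
  have norm: "sq_norm (alg_labels N (b N) A) (marked_input N m) = 1" if "m \<in> {2..N}" for m
    using that W by (rule sq_norm_marked_input)
  have norm0: "sq_norm (alg_labels N (b N) A) (first_input N) = 1"
    using \<open>N \<ge> 2\<close> W by (intro sq_norm_first_input) auto
  \<comment> \<open>The choice \<open>c = 1 / sqrt K\<close> balances the cost from the
    \<open>K\<close> marked runs against that from the single reference run.\<close>
  have "(\<Sum>m\<in>{2..N}. Re (overlap (alg_labels N (b N) A) (marked_input N m) (first_input N))) \<le>
    1 / 7 * (\<Sum>m\<in>{2..N}. (sq_norm (alg_labels N (b N) A) (marked_input N m) +
        sq_norm (alg_labels N (b N) A) (first_input N)) / 2) +
      Q * (1 / sqrt K * (\<Sum>m\<in>{2..N}. sq_norm (alg_labels N (b N) A) (marked_input N m)) +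
        sq_norm (alg_labels N (b N) A) (first_input N) / (1 / sqrt K))"
  proof (rule total_overlap_le_halting[where P = marked_likelihood and ?P0.0 = half_likelihood])
    fix m h flag assume m: "m \<in> {2..N}" and h: "program A h = Halt flag"
    show "Re (overlap (alg_labels N (b N) A) (branch N (b N) (marked_likelihood m) A (marked_input N m) h)
        (branch N (b N) half_likelihood A (first_input N) h)) \<le>
      1 / 7 * ((history_prob N (b N) (marked_likelihood m) A (marked_input N m) h +
        history_prob N (b N) half_likelihood A (first_input N) h) / 2)"
      unfolding history_prob_def
      by (rule overlap_marked_posterior[OF m run(3)[OF valid[OF m] h] run(3)[OF valid0 h]])
  qed (use \<open>K > 0\<close> wf valid valid0 norm norm0 \<open>b N \<ge> 1\<close> in
      \<open>auto intro: run(1) asked likelihood_marked likelihood_half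
        simp: marked_likelihood_def half_likelihood_def\<close>)
  moreover have "Re (overlap (alg_labels N (b N) A) (marked_input N m) (first_input N)) = 1 / 5"
    if "m \<in> {2..N}" for m
    by (simp add: overlap_marked_input[OF that W])
  moreover have "real (card {2..N}) = K"
    by (simp add: K_def)
  ultimately have "K / 5 \<le> K / 7 + Q * (K / sqrt K + sqrt K)"
    using norm norm0 by simp
  then have "2 * K \<le> 70 * Q * sqrt K"
    using \<open>K > 0\<close> by (simp add: real_div_sqrt algebra_simps)
  then have "sqrt K * sqrt K \<le> (35 * Q) * sqrt K"
    using \<open>K > 0\<close> by simp
  then have "sqrt K \<le> 35 * Q"
    by (rule mult_right_le_imp_le) (use \<open>K > 0\<close> in simp)
  then show ?thesis
    by (simp only: K_def Q_def)
qed

text \<open>The update starts with total overlap \<open>K / 5\<close>. Successful branches keep only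
  the fraction 1/7 of their mass; failing ones keep 1/5 up to the cost of undoing, since undoing
  restores the inputs. A success probability \<open>s\<close> of the reference run thus forces a
  loss of at least \<open>K * s / 35\<close>, which the queries of both algorithms must pay
  for.\<close>

lemma undo_queries_lower_bound:
  assumes F: "heralded_update b F" and undo: "undoes_failure b F H q" and "b N \<ge> 1" and "N \<ge> 2"
    and queries: "\<And>P \<alpha>. (N, 1, P, \<alpha>) \<in> valid_problems b \<Longrightarrow>
      queries_at_most N (b N) P (F N 1) (input_state \<alpha> N) qF"
  shows "success_prob b F (N, 1, half_likelihood, \<lambda>x. of_real (first_state x)) * sqrt (real (N - 1)) \<le>
    70 * (real qF + real (q N))"
proof -
  define K where "K = real (N - 1)"
  define A where "A = F N 1"
  define B where "B = alg_labels N (b N) A"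
  define \<psi> where "\<psi> m = branch N (b N) (marked_likelihood m) A (marked_input N m)" for m
  define \<phi> where "\<phi> = branch N (b N) half_likelihood A (first_input N)"
  define p where "p m = history_prob N (b N) (marked_likelihood m) A (marked_input N m)" for m
  define p0 where "p0 = history_prob N (b N) half_likelihood A (first_input N)"
  \<comment> \<open>\<open>a\<close> is the mass to which relative overlaps refer; \<open>e\<close>
    is the cost in a branch for each query allowed to the undoing algorithm.\<close>
  define a where "a h = (\<Sum>m\<in>{2..N}. (p m h + p0 h) / 2)" for h
  define e where "e h = 1 / sqrt K * (\<Sum>m\<in>{2..N}. p m h) + p0 h / (1 / sqrt K)" for h
  define s where "s = flag_prob N (b N) half_likelihood A (first_input N) True"
  have "K > 0" and card: "real (card {2..N}) = K"
    using \<open>N \<ge> 2\<close> by (auto simp: K_def)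
  have wf: "well_formed N (b N) A"
    using F \<open>N \<ge> 2\<close> by (auto simp: heralded_update_def A_def)
  then have W: "work_dim A > 0"
    by (simp add: well_formed_def)
  have halts: "terminates N (b N) P A (input_state \<alpha> N)"
    and success: "\<And>h. program A h = Halt True \<Longrightarrow>
      holds_state B (updated N P \<alpha>) (branch N (b N) P A (input_state \<alpha> N) h)"
    if "(N, 1, P, \<alpha>) \<in> valid_problems b" for P \<alpha>
    using F that unfolding heralded_update_def A_def B_def by blast+
  have lik: "likelihood N (b N) (marked_likelihood m)" for m
    using \<open>b N \<ge> 1\<close> by (rule likelihood_marked)
  have lik0: "likelihood N (b N) half_likelihood"
    using \<open>b N \<ge> 1\<close> by (rule likelihood_half)
  have agree: "marked_likelihood m x = half_likelihood x" if "x \<noteq> m" for m x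
    using that by (simp add: marked_likelihood_def half_likelihood_def)
  have valid: "(N, 1, marked_likelihood m, \<lambda>x. of_real (marked_prior m x)) \<in> valid_problems b"
    if "m \<in> {2..N}" for m
    using that \<open>b N \<ge> 1\<close> by (rule marked_valid)
  have valid0: "(N, 1, half_likelihood, \<lambda>x. of_real (first_state x)) \<in> valid_problems b"
    using \<open>N \<ge> 2\<close> \<open>b N \<ge> 1\<close> by (intro half_valid) auto
  have norm: "sq_norm B (marked_input N m) = 1" if "m \<in> {2..N}" for m
    unfolding B_def using that W by (rule sq_norm_marked_input)
  have norm0: "sq_norm B (first_input N) = 1"
    unfolding B_def using \<open>N \<ge> 2\<close> W by (intro sq_norm_first_input) auto
  have start: "(\<Sum>m\<in>{2..N}. Re (overlap B (marked_input N m) (first_input N))) = K / 5"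
  proof -
    have "Re (overlap B (marked_input N m) (first_input N)) = 1 / 5" if "m \<in> {2..N}" for m
      by (simp add: B_def overlap_marked_input[OF that W])
    then have "(\<Sum>m\<in>{2..N}. Re (overlap B (marked_input N m) (first_input N))) = (\<Sum>m\<in>{2..N}. 1 / 5)"
      by (rule sum.cong[OF refl])
    then show ?thesis
      using card by simp
  qed
  have p_nonneg: "p m h \<ge> 0" "p0 h \<ge> 0" for m h
    by (simp_all add: p_def p0_def)
  have e_nonneg: "e h \<ge> 0" for h
    using p_nonneg \<open>K > 0\<close> by (simp add: e_def sum_nonneg)
  have p_eq: "p m h = sq_norm B (\<psi> m h)" "p0 h = sq_norm B (\<phi> h)" for m h
    by (simp_all add: p_def p0_def \<psi>_def \<phi>_def B_def history_prob_def)
  have outside: "\<psi> m h (x, y, w) = 0" "\<phi> h (x, y, w) = 0" if "w \<ge> work_dim A" for m h x y w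
    unfolding \<psi>_def \<phi>_def using W that
    by (auto intro!: branch_outside_work simp: input_state_def)
  have success_overlap: "(\<Sum>m\<in>{2..N}. Re (overlap B (\<psi> m h) (\<phi> h))) \<le> 1 / 7 * a h"
    if h: "program A h = Halt True" for h
    unfolding a_def sum_distrib_left p_eq
  proof (rule sum_mono)
    fix m assume m: "m \<in> {2..N}"
    show "Re (overlap B (\<psi> m h) (\<phi> h)) \<le> 1 / 7 * ((sq_norm B (\<psi> m h) + sq_norm B (\<phi> h)) / 2)"
      unfolding B_def \<psi>_def \<phi>_def
      by (rule overlap_marked_posterior[OF m]) (use h success[OF valid[OF m]] success[OF valid0] in
          \<open>simp_all add: B_def\<close>)
  qed
  \<comment> \<open>The states left by the failure are the inputs of the undoing run, whose outputs
    have relative overlap at most 1/5; the bound on lost overlap is thus read backwards.\<close>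
  have failure_overlap: "(\<Sum>m\<in>{2..N}. Re (overlap B (\<psi> m h) (\<phi> h))) \<le> 1 / 5 * a h + real (q N) * e h"
    if h: "program A h = Halt False" for h
  proof -
    define C where "C = H N 1 h"
    have wfC: "well_formed N (b N) C" and dim: "work_dim A \<le> work_dim C"
      using undo h \<open>N \<ge> 2\<close> by (auto simp: undoes_failure_def A_def C_def)
    have run: "terminates N (b N) P C (branch N (b N) P A (input_state \<alpha> N) h)"
      "queries_at_most N (b N) P C (branch N (b N) P A (input_state \<alpha> N) h) (q N)"
      "\<And>g flag. program C g = Halt flag \<Longrightarrow>
        holds_state (alg_labels N (b N) C) \<alpha> (branch N (b N) P C (branch N (b N) P A (input_state \<alpha> N) h) g)"
      if "(N, 1, P, \<alpha>) \<in> valid_problems b" for P \<alpha>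
      using undo h that unfolding undoes_failure_def A_def C_def Let_def by blast+
    have norms: "sq_norm (alg_labels N (b N) C) (\<psi> m h) = p m h"
      "sq_norm (alg_labels N (b N) C) (\<phi> h) = p0 h"
      "overlap (alg_labels N (b N) C) (\<psi> m h) (\<phi> h) = overlap B (\<psi> m h) (\<phi> h)" for m
      using labels_extend[OF dim] outside by (simp_all add: p_eq B_def)
    have "(\<Sum>m\<in>{2..N}. Re (overlap (alg_labels N (b N) C) (\<psi> m h) (\<phi> h))) \<le>
      1 / 5 * (\<Sum>m\<in>{2..N}. (sq_norm (alg_labels N (b N) C) (\<psi> m h) +
          sq_norm (alg_labels N (b N) C) (\<phi> h)) / 2) +
        real (q N) * (1 / sqrt K * (\<Sum>m\<in>{2..N}. sq_norm (alg_labels N (b N) C) (\<psi> m h)) +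
          sq_norm (alg_labels N (b N) C) (\<phi> h) / (1 / sqrt K))"
    proof (rule total_overlap_le_halting[OF wfC _ lik lik0 agree])
      fix m g flag assume m: "m \<in> {2..N}" and g: "program C g = Halt flag"
      show "Re (overlap (alg_labels N (b N) C) (branch N (b N) (marked_likelihood m) C (\<psi> m h) g)
          (branch N (b N) half_likelihood C (\<phi> h) g)) \<le>
        1 / 5 * ((history_prob N (b N) (marked_likelihood m) C (\<psi> m h) g +
          history_prob N (b N) half_likelihood C (\<phi> h) g) / 2)"
        unfolding history_prob_def \<psi>_def \<phi>_def
        by (rule overlap_marked_prior[OF m run(3)[OF valid[OF m] g] run(3)[OF valid0 g]])
    next
      fix m t assume m: "m \<in> {2..N}"
      show "terminates N (b N) (marked_likelihood m) C (\<psi> m h)"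
        unfolding \<psi>_def by (rule run(1)[OF valid[OF m]])
      show "(\<Sum>g\<in>asking C t. history_prob N (b N) (marked_likelihood m) C (\<psi> m h) g) \<le>
          real (q N) * sq_norm (alg_labels N (b N) C) (\<psi> m h)"
        unfolding \<psi>_def by (rule asking_le_queries[OF wfC lik run(2)[OF valid[OF m]]])
    next
      fix t
      show "terminates N (b N) half_likelihood C (\<phi> h)"
        unfolding \<phi>_def by (rule run(1)[OF valid0])
      show "(\<Sum>g\<in>asking C t. history_prob N (b N) half_likelihood C (\<phi> h) g) \<le>
          real (q N) * sq_norm (alg_labels N (b N) C) (\<phi> h)"
        unfolding \<phi>_def by (rule asking_le_queries[OF wfC lik0 run(2)[OF valid0]])
    qed (use \<open>K > 0\<close> in auto)
    then show ?thesis
      by (simp only: norms a_def e_def)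
  qed
  have halted_p: "(\<Sum>h\<in>halted A t. p m h) \<le> 1" if "m \<in> {2..N}" for m t
    using sum_history_prob_leaves[OF wf lik[of m], where \<psi> = "marked_input N m" and t = t] norm[OF that]
      sum_nonneg[of "histories A t" "p m"] p_nonneg(1)
    by (simp add: p_def B_def)
  have halted_p0: "(\<Sum>h\<in>halted A t. p0 h) \<le> 1" for t
    using sum_history_prob_leaves[OF wf lik0, where \<psi> = "first_input N" and t = t] norm0
      sum_nonneg[of "histories A t" p0] p_nonneg(2)
    by (simp add: p0_def B_def)
  have halted_a: "(\<Sum>h\<in>halted A t. a h) \<le> K" for t
  proof -
    have "(\<Sum>h\<in>halted A t. a h) =
        (\<Sum>m\<in>{2..N}. ((\<Sum>h\<in>halted A t. p m h) + (\<Sum>h\<in>halted A t. p0 h)) / 2)"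
      unfolding a_def
      by (subst sum.swap) (simp add: sum.distrib add_divide_distrib sum_divide_distrib)
    also have "\<dots> \<le> (\<Sum>m\<in>{2..N}. 1)"
    proof (rule sum_mono)
      fix m assume "m \<in> {2..N}"
      from halted_p[OF this, of t] halted_p0[of t]
      show "((\<Sum>h\<in>halted A t. p m h) + (\<Sum>h\<in>halted A t. p0 h)) / 2 \<le> 1"
        by simp
    qed
    finally show ?thesis
      using card by simp
  qed
  have halted_e: "(\<Sum>h\<in>halted A t. e h) \<le> 2 * sqrt K" for t
  proof -
    have "(\<Sum>h\<in>halted A t. e h) =
        (\<Sum>m\<in>{2..N}. \<Sum>h\<in>halted A t. p m h) / sqrt K + (\<Sum>h\<in>halted A t. p0 h) * sqrt K"
      by (simp add: e_def sum.distrib sum_distrib_right sum_divide_distrib sum.swap[of _ "halted A t"])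
    also have "\<dots> \<le> (\<Sum>m\<in>{2..N}. 1) / sqrt K + 1 * sqrt K"
      using \<open>K > 0\<close>
      by (intro add_mono divide_right_mono sum_mono mult_right_mono halted_p halted_p0) auto
    also have "(\<Sum>m\<in>{2..N}. 1) = K"
      using card by simp
    finally show ?thesis
      using \<open>K > 0\<close> by (simp add: real_div_sqrt)
  qed
  have "K * s / 35 \<le> 2 * (real qF + real (q N)) * sqrt K"
  proof (rule field_le_epsilon)
    fix \<epsilon> :: real assume "\<epsilon> > 0"
    \<comment> \<open>An error \<open>\<delta>\<close> arises from open branches, and another is
      multiplied by \<open>K / 35\<close> when the success probability is truncated.\<close>
    define \<delta> where "\<delta> = \<epsilon> / (1 + K / 35)"
    have "\<delta> > 0"
      using \<open>\<epsilon> > 0\<close> \<open>K > 0\<close> by (simp add: \<delta>_def add_pos_pos)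
    have "\<forall>\<^sub>F t in sequentially.
      (\<Sum>m\<in>{2..N}. Re (overlap B (marked_input N m) (first_input N))) \<le>
      (\<Sum>h\<in>halted A t. \<Sum>m\<in>{2..N}. Re (overlap B (\<psi> m h) (\<phi> h))) +
        real qF * (1 / sqrt K * (\<Sum>m\<in>{2..N}. sq_norm B (marked_input N m)) +
          sq_norm B (first_input N) / (1 / sqrt K)) + \<delta>"
      unfolding B_def \<psi>_def \<phi>_def
    proof (rule total_overlap_le[OF wf _ lik lik0 agree])
      show "(\<Sum>h\<in>asking A t. history_prob N (b N) (marked_likelihood m) A (marked_input N m) h) \<le>
          real qF * sq_norm (alg_labels N (b N) A) (marked_input N m)" if "m \<in> {2..N}" for m t
        by (rule asking_le_queries[OF wf lik queries[OF valid[OF that], folded A_def]])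
      show "(\<Sum>h\<in>asking A t. history_prob N (b N) half_likelihood A (first_input N) h) \<le>
          real qF * sq_norm (alg_labels N (b N) A) (first_input N)" for t
        by (rule asking_le_queries[OF wf lik0 queries[OF valid0, folded A_def]])
      show "terminates N (b N) (marked_likelihood m) A (marked_input N m)" if "m \<in> {2..N}" for m
        by (rule halts[OF valid[OF that]])
      show "terminates N (b N) half_likelihood A (first_input N)"
        by (rule halts[OF valid0])
    qed (use \<open>K > 0\<close> \<open>\<delta> > 0\<close> in auto)
    moreover have "\<forall>\<^sub>F t in sequentially. s < (\<Sum>h\<in>flagged A True t. p0 h) + \<delta>"
      unfolding s_def p0_def by (rule flag_prob_less_flagged[OF \<open>\<delta> > 0\<close>])
    ultimately have "\<forall>\<^sub>F t in sequentially. K * s / 35 \<le> 2 * (real qF + real (q N)) * sqrt K + \<epsilon>"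
    proof eventually_elim
      case (elim t)
      have "(\<Sum>h\<in>flagged A False t. real (q N) * e h) \<le> real (q N) * (\<Sum>h\<in>halted A t. e h)"
        unfolding sum_halted sum_distrib_left[symmetric]
        by (intro mult_left_mono) (simp_all add: e_nonneg sum_nonneg)
      also have "\<dots> \<le> real (q N) * (2 * sqrt K)"
        by (intro mult_left_mono halted_e) simp
      finally have undo_cost: "(\<Sum>h\<in>flagged A False t. real (q N) * e h) \<le> real (q N) * (2 * sqrt K)" .
      have "(\<Sum>h\<in>halted A t. \<Sum>m\<in>{2..N}. Re (overlap B (\<psi> m h) (\<phi> h))) \<le>
          (\<Sum>h\<in>flagged A True t. 1 / 7 * a h) + (\<Sum>h\<in>flagged A False t. 1 / 5 * a h + real (q N) * e h)"
        unfolding sum_halted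
        by (intro add_mono sum_mono success_overlap failure_overlap) (auto simp: flagged_def)
      also have "\<dots> \<le> 1 / 5 * (\<Sum>h\<in>halted A t. a h) - 2 / 35 * (\<Sum>h\<in>flagged A True t. a h) +
          real (q N) * (2 * sqrt K)"
        using undo_cost unfolding sum_halted sum.distrib sum_distrib_left[symmetric]
        by (simp add: algebra_simps)
      also have "\<dots> \<le> 1 / 5 * K - 2 / 35 * (\<Sum>h\<in>flagged A True t. a h) + real (q N) * (2 * sqrt K)"
        using halted_a[of t] by simp
      finally have total: "(\<Sum>h\<in>halted A t. \<Sum>m\<in>{2..N}. Re (overlap B (\<psi> m h) (\<phi> h))) \<le>
          1 / 5 * K - 2 / 35 * (\<Sum>h\<in>flagged A True t. a h) + real (q N) * (2 * sqrt K)" .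
      \<comment> \<open>Only the reference half of \<open>a\<close> is kept, so that a lower bound
        on the success probability in the reference run suffices.\<close>
      have "K / 2 * p0 h \<le> a h" for h
        unfolding a_def card[symmetric] using p_nonneg
        by (simp add: sum.distrib add_divide_distrib sum_nonneg)
      then have "(\<Sum>h\<in>flagged A True t. K / 2 * p0 h) \<le> (\<Sum>h\<in>flagged A True t. a h)"
        by (rule sum_mono)
      then have "K / 2 * (\<Sum>h\<in>flagged A True t. p0 h) \<le> (\<Sum>h\<in>flagged A True t. a h)"
        by (simp add: sum_distrib_left)
      moreover have "K / 2 * (s - \<delta>) \<le> K / 2 * (\<Sum>h\<in>flagged A True t. p0 h)"
        using elim(2) \<open>K > 0\<close> by (intro mult_left_mono) auto
      ultimately have mass: "K / 2 * (s - \<delta>) \<le> (\<Sum>h\<in>flagged A True t. a h)"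
        by linarith
      have "K / 5 \<le> (\<Sum>h\<in>halted A t. \<Sum>m\<in>{2..N}. Re (overlap B (\<psi> m h) (\<phi> h))) +
          real qF * (2 * sqrt K) + \<delta>"
        using elim(1) norm norm0 card \<open>K > 0\<close>
        unfolding start by (simp add: real_div_sqrt)
      with total have "2 / 35 * (\<Sum>h\<in>flagged A True t. a h) \<le>
          real qF * (2 * sqrt K) + real (q N) * (2 * sqrt K) + \<delta>"
        by linarith
      with mass have "K * s / 35 \<le> 2 * (real qF + real (q N)) * sqrt K + \<delta> * (1 + K / 35)"
        by (simp add: algebra_simps)
      also have "\<delta> * (1 + K / 35) = \<epsilon>"
        using \<open>K > 0\<close> by (simp add: \<delta>_def add_pos_pos)
      finally show ?case .
    qed
    then show "K * s / 35 \<le> 2 * (real qF + real (q N)) * sqrt K + \<epsilon>"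
      by simp
  qed
  then have "(s * sqrt K) * sqrt K \<le> (70 * (real qF + real (q N))) * sqrt K"
    using \<open>K > 0\<close> by (simp add: algebra_simps)
  then have "s * sqrt K \<le> 70 * (real qF + real (q N))"
    by (rule mult_right_le_imp_le) (use \<open>K > 0\<close> in simp)
  then show ?thesis
    by (simp add: success_prob_def s_def K_def A_def)
qed

section \<open>Unstructured search as a Bayesian update of the uniform prior\<close>

definition search_likelihood :: "nat \<Rightarrow> nat \<Rightarrow> real" where
  "search_likelihood m x = (if x = m then 1 else 0)"

definition uniform_state :: "nat \<Rightarrow> nat \<Rightarrow> complex" where
  "uniform_state N x = of_real (1 / sqrt (real N))"

lemma evidence_search:
  assumes "m \<in> {1..N}"
  shows "evidence N (search_likelihood m) (uniform_state N) = 1 / real N"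
proof -
  have "evidence N (search_likelihood m) (uniform_state N) =
      (\<Sum>x\<in>{m}. (cmod (uniform_state N x))\<^sup>2 * search_likelihood m x)"
    unfolding evidence_def using assms
    by (intro sum.mono_neutral_right) (auto simp: search_likelihood_def)
  then show ?thesis
    by (simp add: search_likelihood_def uniform_state_def power_divide norm_divide)
qed

lemma sum_uniform_state: "N \<ge> 1 \<Longrightarrow> (\<Sum>x=1..N. (cmod (uniform_state N x))\<^sup>2) = 1"
  by (simp add: uniform_state_def power_divide norm_divide)

lemma likelihood_search: "likelihood N b (search_likelihood m)"
  unfolding likelihood_def search_likelihood_def using one_dyadic zero_dyadic by simp

lemma search_valid:
  assumes "m \<in> {1..N}"
  shows "(N, 1, search_likelihood m, uniform_state N) \<in> valid_problems b"
  using assms sum_uniform_state[of N] evidence_search[of m N] likelihood_search[of N "b N" m]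
  by (auto simp: valid_problems_def search_likelihood_def)

text \<open>The posterior is concentrated on \<open>m\<close>, so the success probability is at most
  the halting weight at \<open>m\<close>. The sum of these weights over all \<open>m\<close> is
  bounded independently of \<open>N\<close>, and some \<open>m\<close> lies at or below the
  average.\<close>

lemma search_success_upper_bound:
  assumes G: "heralded_update b G" and "N \<ge> 1"
    and queries: "\<And>P \<alpha>. (N, 1, P, \<alpha>) \<in> valid_problems b \<Longrightarrow>
      queries_at_most N (b N) P (G N 1) (input_state \<alpha> N) T"
  shows "\<exists>m\<in>{1..N}. success_prob b G (N, 1, search_likelihood m, uniform_state N) \<le>
    (16 * 2 ^ T * real T + 2) / real N"
proof -
  define A where "A = G N 1"
  define B where "B = alg_labels N (b N) A"
  define \<phi> where "\<phi> = input_state (uniform_state N) N"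
  define p where "p m = history_prob N (b N) (search_likelihood m) A \<phi>" for m
  define s where "s m = flag_prob N (b N) (search_likelihood m) A \<phi> True" for m
  define c where "c = 16 * 2 ^ T * real T + 2"
  have wf: "well_formed N (b N) A"
    using G \<open>N \<ge> 1\<close> by (auto simp: heralded_update_def A_def)
  then have W: "work_dim A > 0"
    by (simp add: well_formed_def)
  have norm: "sq_norm B \<phi> = 1"
    using W sum_uniform_state[OF \<open>N \<ge> 1\<close>] by (simp add: B_def \<phi>_def sq_norm_input_state)
  have success: "holds_state B (updated N (search_likelihood m) (uniform_state N))
      (branch N (b N) (search_likelihood m) A \<phi> h)"
    if "m \<in> {1..N}" "program A h = Halt True" for m h
    using G search_valid[OF that(1)] that(2) unfolding heralded_update_def A_def B_def \<phi>_def by blast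
  have flagged_p: "(\<Sum>m\<in>{1..N}. \<Sum>h\<in>flagged A True t. p m h) \<le> c" for t
  proof -
    have "(\<Sum>h\<in>flagged A True t. p m h) \<le> (\<Sum>h\<in>{h \<in> halted A t. num_queries A h \<le> T}.
        sq_norm (latent B m) (branch N (b N) (search_likelihood m) A \<phi> h))" if m: "m \<in> {1..N}" for m
    proof -
      \<comment> \<open>The cut at \<open>T\<close> queries loses nothing in the marked runs. The
        reference run with likelihood 0 has evidence 0, is no valid problem, and may query more
        often.\<close>
      have zero: "p m h = 0" if "\<not> num_queries A h \<le> T" for h
      proof -
        have "\<not> p m h > 0"
          using that queries[OF search_valid[OF m]]
          unfolding queries_at_most_def p_def A_def \<phi>_def by blast
        then show ?thesis
          using history_prob_nonneg[of N "b N" "search_likelihood m" A \<phi> h]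
          unfolding p_def by linarith
      qed
      have "p m h \<le> sq_norm (latent B m) (branch N (b N) (search_likelihood m) A \<phi> h)"
        if h: "program A h = Halt True" for h
      proof -
        obtain v where v: "\<forall>(x, y, w)\<in>B. branch N (b N) (search_likelihood m) A \<phi> h (x, y, w) =
            updated N (search_likelihood m) (uniform_state N) x * v (y, w)"
          using success[OF m h] unfolding holds_state_def by blast
        have "branch N (b N) (search_likelihood m) A \<phi> h i = 0" if "i \<in> B - latent B m" for i
          using that v by (cases i) (auto simp: latent_def updated_def search_likelihood_def)
        then have zero: "\<forall>i\<in>B - latent B m. (cmod (branch N (b N) (search_likelihood m) A \<phi> h i))\<^sup>2 = 0"
          by simp
        have "finite B" "latent B m \<subseteq> B"
          by (auto simp: latent_def B_def)
        from sum.mono_neutral_right[OF this zero] show ?thesis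
          by (simp add: p_def history_prob_def sq_norm_def B_def)
      qed
      then have "(\<Sum>h\<in>flagged A True t. p m h) \<le> (\<Sum>h\<in>flagged A True t.
          if num_queries A h \<le> T then sq_norm (latent B m) (branch N (b N) (search_likelihood m) A \<phi> h) else 0)"
        using zero by (intro sum_mono) (auto simp: flagged_def)
      also have "\<dots> \<le> (\<Sum>h\<in>halted A t.
          if num_queries A h \<le> T then sq_norm (latent B m) (branch N (b N) (search_likelihood m) A \<phi> h) else 0)"
        by (intro sum_mono2) (auto simp: flagged_def halted_def)
      finally show ?thesis
        by (simp add: sum.inter_filter)
    qed
    then have "(\<Sum>m\<in>{1..N}. \<Sum>h\<in>flagged A True t. p m h) \<le>
      (\<Sum>m\<in>{1..N}. \<Sum>h\<in>{h \<in> halted A t. num_queries A h \<le> T}.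
        sq_norm (latent B m) (branch N (b N) (search_likelihood m) A \<phi> h))"
      by (rule sum_mono)
    also have "\<dots> \<le> c * sq_norm B \<phi>"
      unfolding c_def B_def
      by (rule total_latent_mass_le[OF wf, where ?P0.0 = "\<lambda>_. 0"])
        (use likelihood_search zero_dyadic in \<open>auto simp: search_likelihood_def[of _ x for x] likelihood_def\<close>)
    finally show ?thesis
      using norm by simp
  qed
  have "(\<Sum>m\<in>{1..N}. s m) \<le> c"
  proof (rule field_le_epsilon)
    fix \<epsilon> :: real assume "\<epsilon> > 0"
    define \<delta> where "\<delta> = \<epsilon> / real N"
    have "\<delta> > 0"
      using \<open>\<epsilon> > 0\<close> \<open>N \<ge> 1\<close> by (simp add: \<delta>_def)
    have "\<forall>\<^sub>F t in sequentially. \<forall>m\<in>{1..N}. s m < (\<Sum>h\<in>flagged A True t. p m h) + \<delta>"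
      unfolding s_def p_def
      by (intro eventually_ball_finite ballI flag_prob_less_flagged \<open>\<delta> > 0\<close>) simp
    from eventually_happens'[OF sequentially_bot this]
    obtain t where "\<And>m. m \<in> {1..N} \<Longrightarrow> s m < (\<Sum>h\<in>flagged A True t. p m h) + \<delta>"
      by blast
    then have "(\<Sum>m\<in>{1..N}. s m) \<le> (\<Sum>m\<in>{1..N}. (\<Sum>h\<in>flagged A True t. p m h) + \<delta>)"
      by (intro sum_mono) (auto intro: less_imp_le)
    also have "\<dots> = (\<Sum>m\<in>{1..N}. \<Sum>h\<in>flagged A True t. p m h) + \<epsilon>"
      using \<open>N \<ge> 1\<close> by (simp add: sum.distrib \<delta>_def)
    finally show "(\<Sum>m\<in>{1..N}. s m) \<le> c + \<epsilon>"
      using flagged_p[of t] by linarith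
  qed
  have "\<exists>m\<in>{1..N}. s m \<le> c / real N"
  proof (rule ccontr)
    assume "\<not> ?thesis"
    then have "c / real N < s m" if "m \<in> {1..N}" for m
      using that not_le by blast
    then have "(\<Sum>m\<in>{1..N}. c / real N) < (\<Sum>m\<in>{1..N}. s m)"
      using \<open>N \<ge> 1\<close> by (intro sum_strict_mono) auto
    with \<open>(\<Sum>m\<in>{1..N}. s m) \<le> c\<close> \<open>N \<ge> 1\<close> show False
      by simp
  qed
  then show ?thesis
    by (simp add: success_prob_def s_def c_def A_def \<phi>_def)
qed

section \<open>From the bounds for fixed N to the asymptotic statements\<close>

lemma success_prob_nonneg: "success_prob b F p \<ge> 0"
  by (cases p) (simp add: success_prob_def flag_prob_def infsum_nonneg)

lemma queries_at_most_mono: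
  "queries_at_most N b P A \<psi> q \<Longrightarrow> q \<le> q' \<Longrightarrow> queries_at_most N b P A \<psi> q'"
  unfolding queries_at_most_def by (meson order_trans)

lemma constant_queriesE:
  assumes "constant_queries b F"
  obtains T where "\<forall>\<^sub>F N in sequentially. \<forall>P \<alpha>. (N, 1, P, \<alpha>) \<in> valid_problems b \<longrightarrow>
    queries_at_most N (b N) P (F N 1) (input_state \<alpha> N) T"
proof -
  obtain q where q: "(\<lambda>N. real (q N)) \<in> O(\<lambda>_. 1)"
    and F: "\<forall>(N, \<Gamma>, P, \<alpha>)\<in>valid_problems b. queries_at_most N (b N) P (F N \<Gamma>) (input_state \<alpha> N) (q N)"
    using assms unfolding constant_queries_def by blast
  obtain c where c: "\<forall>\<^sub>F N in sequentially. norm (real (q N)) \<le> c * norm (1 :: real)"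
    using q by (rule landau_o.bigE)
  have "\<forall>\<^sub>F N in sequentially. \<forall>P \<alpha>. (N, 1, P, \<alpha>) \<in> valid_problems b \<longrightarrow>
      queries_at_most N (b N) P (F N 1) (input_state \<alpha> N) (nat \<lceil>c\<rceil>)"
    using c
  proof eventually_elim
    case (elim N)
    then have "q N \<le> nat \<lceil>c\<rceil>"
      by simp linarith
    then show ?case
      using F by (blast intro: queries_at_most_mono)
  qed
  then show thesis
    by (rule that)
qed

text \<open>Choosing a bad marked value for each \<open>N\<close> gives a sequence of problems along
  the filter of hard problems: its scaled evidence \<open>1 / N\<close> tends to 0, yet success
  stays below \<open>c / N\<close>.\<close>

lemma no_superlinear_update:
  assumes G: "heralded_update b G" and queries: "constant_queries b G"
    and omega: "success_prob b G \<in> \<omega>[large_hard_problems b](scaled_evidence)"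
  shows False
proof -
  obtain T where T: "\<forall>\<^sub>F N in sequentially. \<forall>P \<alpha>. (N, 1, P, \<alpha>) \<in> valid_problems b \<longrightarrow>
      queries_at_most N (b N) P (G N 1) (input_state \<alpha> N) T"
    using queries by (rule constant_queriesE)
  define c where "c = 16 * 2 ^ T * real T + 2"
  have "c > 0"
    by (auto simp: c_def intro: add_nonneg_pos)
  have "\<forall>\<^sub>F N in sequentially. \<exists>m. m \<in> {1..N} \<and>
      success_prob b G (N, 1, search_likelihood m, uniform_state N) \<le> c / real N"
    using T eventually_ge_at_top[of 1]
  proof eventually_elim
    case (elim N)
    then show ?case
      using search_success_upper_bound[OF G, of N T] unfolding c_def by blast
  qed
  then obtain m where m: "\<forall>\<^sub>F N in sequentially. m N \<in> {1..N} \<and>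
      success_prob b G (N, 1, search_likelihood (m N), uniform_state N) \<le> c / real N"
    unfolding eventually_ex by blast
  define p where "p N = (N, 1 :: real, search_likelihood (m N), uniform_state N)" for N
  have scaled: "\<forall>\<^sub>F N in sequentially. scaled_evidence (p N) = 1 / real N"
    using m by eventually_elim (simp add: scaled_evidence_def p_def evidence_search)
  have "filterlim p (large_hard_problems b) sequentially"
    unfolding large_hard_problems_def large_problems_def filterlim_inf filterlim_principal
      filterlim_filtercomap_iff
  proof (intro conjI)
    show "filterlim (fst \<circ> p) at_top sequentially"
      by (simp add: p_def comp_def filterlim_ident)
    show "\<forall>\<^sub>F N in sequentially. p N \<in> valid_problems b"
      using m by eventually_elim (simp add: p_def search_valid)
    have "(\<lambda>N. 1 / real N) \<longlonglongrightarrow> 0"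
      by (rule lim_1_over_n)
    then show "filterlim (scaled_evidence \<circ> p) (nhds 0) sequentially"
      unfolding comp_def using scaled
      by (rule Lim_transform_eventually[OF _ eventually_mono]) simp
  qed
  \<comment> \<open>Any factor above \<open>c\<close> contradicts the bound along the
    sequence.\<close>
  moreover have "\<forall>\<^sub>F x in large_hard_problems b. norm (success_prob b G x) \<ge> (c + 1) * norm (scaled_evidence x)"
    using omega \<open>c > 0\<close> unfolding smallomega_def by auto
  ultimately have "\<forall>\<^sub>F N in sequentially.
      norm (success_prob b G (p N)) \<ge> (c + 1) * norm (scaled_evidence (p N))"
    by (rule eventually_compose_filterlim[rotated])
  then have "\<forall>\<^sub>F N :: nat in sequentially. False"
    using m scaled eventually_gt_at_top[of 0]
  proof eventually_elim
    case (elim N)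
    have "(c + 1) / real N \<le> c / real N"
      using elim success_prob_nonneg[of b G "p N"] by (simp add: p_def)
    with \<open>N > 0\<close> show False
      by (simp add: divide_right_mono_neg field_simps)
  qed
  then show False
    by simp
qed

lemma no_sublinear_sqrt:
  fixes f :: "nat \<Rightarrow> real"
  assumes f: "f \<in> o(\<lambda>N. sqrt (real N))" and "d > 0"
    and le: "\<forall>\<^sub>F N in sequentially. d * sqrt (real (N - 1)) \<le> c + f N"
  shows False
proof -
  \<comment> \<open>The left side is at least \<open>d / 2 * sqrt N\<close>, so after subtracting
    \<open>f\<close> a quarter of \<open>d * sqrt N\<close> still outgrows the constant.\<close>
  have "\<forall>\<^sub>F N in sequentially. norm (f N) \<le> d / 4 * norm (sqrt (real N))"
    using f \<open>d > 0\<close> by (intro landau_o.smallD) auto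
  moreover have "\<forall>\<^sub>F N in sequentially. sqrt (real N) > 4 * c / d"
    using filterlim_compose[OF sqrt_at_top filterlim_real_sequentially]
    by (simp add: filterlim_at_top_dense)
  ultimately have "\<forall>\<^sub>F N :: nat in sequentially. False"
    using le eventually_ge_at_top[of 2]
  proof eventually_elim
    case (elim N)
    have "sqrt (real N) / 2 = sqrt (real N / 4)"
      by (simp add: real_sqrt_divide)
    also have "\<dots> \<le> sqrt (real (N - 1))"
      using \<open>N \<ge> 2\<close> by simp
    finally have "d * (sqrt (real N) / 2) \<le> d * sqrt (real (N - 1))"
      using \<open>d > 0\<close> by (intro mult_left_mono) auto
    then have "d * sqrt (real N) / 4 \<le> c"
      using elim by (simp add: abs_le_iff)
    then show False
      using elim(2) \<open>d > 0\<close> by (simp add: field_simps)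
  qed
  then show False
    by simp
qed

lemma no_cheap_undo:
  assumes b: "\<And>N. b N \<ge> 1" and F: "heralded_update b F" and queries: "constant_queries b F"
    and omega: "success_prob b F \<in> \<Omega>[large_problems b](scaled_evidence)"
    and q: "(\<lambda>N. real (q N)) \<in> o(\<lambda>N. sqrt (real N) / ln (real N))"
    and undo: "undoes_failure b F H q"
  shows False
proof -
  obtain T where T: "\<forall>\<^sub>F N in sequentially. \<forall>P \<alpha>. (N, 1, P, \<alpha>) \<in> valid_problems b \<longrightarrow>
      queries_at_most N (b N) P (F N 1) (input_state \<alpha> N) T"
    using queries by (rule constant_queriesE)
  define p where "p N = (N, 1 :: real, half_likelihood, \<lambda>x. complex_of_real (first_state x))" for N :: nat
  have lim: "filterlim p (large_problems b) sequentially"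
    unfolding large_problems_def filterlim_inf filterlim_principal filterlim_filtercomap_iff
  proof (intro conjI)
    show "filterlim (fst \<circ> p) at_top sequentially"
      by (simp add: p_def comp_def filterlim_ident)
    show "\<forall>\<^sub>F N in sequentially. p N \<in> valid_problems b"
      using eventually_ge_at_top[of 1] by eventually_elim (use b half_valid in \<open>simp add: p_def\<close>)
  qed
  obtain c where "c > 0" and
    c: "\<forall>\<^sub>F x in large_problems b. norm (success_prob b F x) \<ge> c * norm (scaled_evidence x)"
    using omega by (rule landau_omega.bigE)
  have success: "\<forall>\<^sub>F N in sequentially.
      norm (success_prob b F (p N)) \<ge> c * norm (scaled_evidence (p N))"
    by (rule eventually_compose_filterlim[OF c lim])
  \<comment> \<open>The logarithm only strengthens the assumption on \<open>q\<close>, since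
    \<open>ln N\<close> is at least 1 from 3 on.\<close>
  have "(\<lambda>N. sqrt (real N) / ln (real N)) \<in> O(\<lambda>N. sqrt (real N))"
  proof (rule landau_o.bigI[of 1])
    show "\<forall>\<^sub>F N in sequentially. norm (sqrt (real N) / ln (real N)) \<le> 1 * norm (sqrt (real N))"
      using eventually_ge_at_top[of 3]
    proof eventually_elim
      case (elim N)
      have "exp 1 \<le> real N"
        using exp_le elim by linarith
      then have "ln (real N) \<ge> 1"
        using elim by (simp add: ln_ge_iff)
      then show ?case
        using mult_left_mono[of 1 "ln (real N)" "sqrt (real N)"] by (simp add: divide_le_eq)
    qed
  qed simp
  with q have "(\<lambda>N. real (q N)) \<in> o(\<lambda>N. sqrt (real N))"
    by (rule landau_o.small_big_trans)
  then have "(\<lambda>N. 70 * real (q N)) \<in> o(\<lambda>N. sqrt (real N))"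
    by simp
  moreover have "c / 2 > 0"
    using \<open>c > 0\<close> by simp
  moreover have "\<forall>\<^sub>F N in sequentially. c / 2 * sqrt (real (N - 1)) \<le> 70 * real T + 70 * real (q N)"
    using success T eventually_ge_at_top[of 2]
  proof eventually_elim
    case (elim N)
    \<comment> \<open>The reference problem has scaled evidence 1/2 for every \<open>N\<close>, so
      its success probability is bounded below by a constant.\<close>
    have "c / 2 \<le> success_prob b F (p N)"
      using elim success_prob_nonneg[of b F "p N"]
      by (simp add: p_def scaled_evidence_def evidence_half)
    then have "c / 2 * sqrt (real (N - 1)) \<le> success_prob b F (p N) * sqrt (real (N - 1))"
      by (intro mult_right_mono) auto
    also have "\<dots> \<le> 70 * (real T + real (q N))"
      unfolding p_def using elim(2)
      by (intro undo_queries_lower_bound[OF F undo b \<open>N \<ge> 2\<close>]) blast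
    finally show ?case
      by simp
  qed
  ultimately show False
    by (rule no_sublinear_sqrt)
qed

lemma no_cheap_expected_update:
  assumes b: "\<And>N. b N \<ge> 1" and q: "q \<in> o(\<lambda>N. sqrt (real N))"
    and update: "update_with_expected_queries b I q"
  shows False
proof (rule no_sublinear_sqrt)
  show "(\<lambda>N. 35 * norm (q N)) \<in> o(\<lambda>N. sqrt (real N))"
    using q by simp
  show "\<forall>\<^sub>F N in sequentially. 1 * sqrt (real (N - 1)) \<le> 0 + 35 * norm (q N)"
    using eventually_ge_at_top[of 2]
  proof eventually_elim
    case (elim N)
    have "max (q N) 0 \<le> norm (q N)"
      by simp
    then show ?case
      using expected_queries_lower_bound[OF update b elim] by linarith
  qed
qed simp

theorem theorem1:
  fixes b :: "nat \<Rightarrow> nat" and F :: "nat \<Rightarrow> real \<Rightarrow> algorithm"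
  assumes "\<And>N. b N \<ge> 1"
    and "heralded_update b F"
    and "constant_queries b F"
    and "success_prob b F \<in> \<Omega>[large_problems b](scaled_evidence)"
  shows "(\<nexists>G :: nat \<Rightarrow> real \<Rightarrow> algorithm.
            heralded_update b G \<and> constant_queries b G \<and>
            success_prob b G \<in> \<omega>[large_hard_problems b](scaled_evidence)) \<and>
         (\<nexists>(H :: nat \<Rightarrow> real \<Rightarrow> nat list \<Rightarrow> algorithm) (q :: nat \<Rightarrow> nat).
            (\<lambda>N. real (q N)) \<in> o(\<lambda>N. sqrt (real N) / ln (real N)) \<and> undoes_failure b F H q) \<and>
         (\<nexists>(I :: nat \<Rightarrow> algorithm) (q :: nat \<Rightarrow> real).
            q \<in> o(\<lambda>N. sqrt (real N)) \<and> update_with_expected_queries b I q)"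
proof (intro conjI notI; elim exE conjE)
  show False if "heralded_update b G" "constant_queries b G"
    "success_prob b G \<in> \<omega>[large_hard_problems b](scaled_evidence)" for G
    using that by (rule no_superlinear_update)
  show False if "(\<lambda>N. real (q N)) \<in> o(\<lambda>N. sqrt (real N) / ln (real N))" "undoes_failure b F H q" for H q
    using assms that by (rule no_cheap_undo)
  show False if "q \<in> o(\<lambda>N. sqrt (real N))" "update_with_expected_queries b I q" for I q
    using assms(1) that by (rule no_cheap_expected_update)
qed

end
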